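(* Let $G$ be a finite group and let $H$ be a subgroup of $G$. Then $|\mathcal{I}(G,H)| \neq 4$, i.e. the number of isomorphism classes of right loops arising as normalized right transversals of $H$ in $G$ is not equal to four.
   Context: A normalized right transversal (NRT) of $H$ in $G$ is a subset $S\subseteq G$ containing exactly one element of each right coset $Hx$ of $H$ in $G$, with $1\in S$. $\mathcal{T}(G,H)$ denotes the set of all NRTs of $H$ in $G$. Each $S\in\mathcal{T}(G,H)$ carries the induced binary operation $\circ$ given by $\{x\circ y\}=Hxy\cap S$, which makes $S$ a right loop with identity $1$ (that is, $1$ is a two-sided identity and for all $a,b\in S$ the equation $X\circ a=b$ has a unique solution $X\in S$). For $S,T\in\mathcal{T}(G,H)$, $S\cong T$ means that there is a bijection $S\to T$ preserving the induced operations. $\mathcal{I}(G,H)$ denotes the set of isomorphism classes of elements of $\mathcal{T}(G,H)$. *)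

theory Defs
  imports "HOL-Algebra.Coset"
begin

definition NRT :: "('a, 'm) monoid_scheme \<Rightarrow> 'a set \<Rightarrow> 'a set set"
  where "NRT G H =
    {S. S \<subseteq> carrier G \<and> \<one>\<^bsub>G\<^esub> \<in> S \<and> (\<forall>C \<in> rcosets\<^bsub>G\<^esub> H. \<exists>!x. x \<in> C \<inter> S)}"

definition nrt_op :: "('a, 'm) monoid_scheme \<Rightarrow> 'a set \<Rightarrow> 'a set \<Rightarrow> 'a \<Rightarrow> 'a \<Rightarrow> 'a"
  where "nrt_op G H S x y = (THE z. z \<in> (H #>\<^bsub>G\<^esub> (x \<otimes>\<^bsub>G\<^esub> y)) \<inter> S)"

text \<open>The right loop is packaged in the library's \<^type>\<open>monoid_ext\<close> record only to have a carrier with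
  an operation and an identity; the operation need not be associative. The library's
  \<^const>\<open>iso\<close> on such records asks for a bijection of carriers that preserves the operation and
  assumes no group or monoid axioms.\<close>

definition nrt_loop :: "('a, 'm) monoid_scheme \<Rightarrow> 'a set \<Rightarrow> 'a set \<Rightarrow> 'a monoid"
  where "nrt_loop G H S = \<lparr>carrier = S, mult = nrt_op G H S, one = \<one>\<^bsub>G\<^esub>\<rparr>"

definition nrt_iso_rel :: "('a, 'm) monoid_scheme \<Rightarrow> 'a set \<Rightarrow> ('a set \<times> 'a set) set"
  where "nrt_iso_rel G H =
    {(S, T). S \<in> NRT G H \<and> T \<in> NRT G H \<and> nrt_loop G H S \<cong> nrt_loop G H T}"

definition nrt_iso_classes :: "('a, 'm) monoid_scheme \<Rightarrow> 'a set \<Rightarrow> 'a set set set"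
  where "nrt_iso_classes G H = NRT G H // nrt_iso_rel G H"

lemma nrt_op_spec:
  assumes "group G" "subgroup H G" "S \<in> NRT G H" "x \<in> S" "y \<in> S"
  shows "(H #>\<^bsub>G\<^esub> (x \<otimes>\<^bsub>G\<^esub> y)) \<inter> S = {nrt_op G H S x y}"
proof -
  interpret group G by fact
  have "x \<otimes>\<^bsub>G\<^esub> y \<in> carrier G" using assms unfolding NRT_def by blast
  then have "H #>\<^bsub>G\<^esub> (x \<otimes>\<^bsub>G\<^esub> y) \<in> rcosets\<^bsub>G\<^esub> H" by (auto simp: RCOSETS_def)
  then have ex: "\<exists>!z. z \<in> (H #>\<^bsub>G\<^esub> (x \<otimes>\<^bsub>G\<^esub> y)) \<inter> S" using assms(3) unfolding NRT_def by blast
  from theI'[OF ex] ex show ?thesis unfolding nrt_op_def by blast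
qed

lemma equiv_nrt_iso_rel:
  assumes "group G" "subgroup H G"
  shows "equiv (NRT G H) (nrt_iso_rel G H)"
proof (rule equivI)
  show "nrt_iso_rel G H \<subseteq> NRT G H \<times> NRT G H"
    by (auto simp: nrt_iso_rel_def)
  show "refl_on (NRT G H) (nrt_iso_rel G H)"
    by (auto simp: refl_on_def nrt_iso_rel_def iso_refl)
  show "trans (nrt_iso_rel G H)"
    by (auto simp: trans_def nrt_iso_rel_def intro: iso_trans)
  show "sym (nrt_iso_rel G H)"
  proof (rule symI)
    fix S T assume "(S, T) \<in> nrt_iso_rel G H"
    then have S: "S \<in> NRT G H" and T: "T \<in> NRT G H" and "nrt_loop G H S \<cong> nrt_loop G H T"
      by (auto simp: nrt_iso_rel_def)
    then obtain f where bij: "bij_betw f S T"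
      and hom: "\<And>x y. x \<in> S \<Longrightarrow> y \<in> S \<Longrightarrow> f (nrt_op G H S x y) = nrt_op G H T (f x) (f y)"
      by (auto simp: is_iso_def iso_def hom_def nrt_loop_def)
    let ?g = "inv_into S f"
    have g: "bij_betw ?g T S" by (rule bij_betw_inv_into[OF bij])
    have "?g (nrt_op G H T x y) = nrt_op G H S (?g x) (?g y)" if "x \<in> T" "y \<in> T" for x y
    proof -
      have *: "?g x \<in> S" "?g y \<in> S" using g that by (auto dest: bij_betwE)
      have "nrt_op G H T x y = f (nrt_op G H S (?g x) (?g y))"
        using hom[OF *] bij that by (simp add: bij_betw_inv_into_right)
      moreover have "nrt_op G H S (?g x) (?g y) \<in> S"
        using nrt_op_spec[OF assms S *] by blast
      ultimately show ?thesis using bij by (simp add: bij_betw_inv_into_left)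
    qed
    moreover have "nrt_op G H T x y \<in> T" if "x \<in> T" "y \<in> T" for x y
      using nrt_op_spec[OF assms T that] by blast
    ultimately have "?g \<in> iso (nrt_loop G H T) (nrt_loop G H S)"
      using g by (auto simp: iso_def hom_def nrt_loop_def dest: bij_betwE)
    then show "(T, S) \<in> nrt_iso_rel G H"
      using S T by (auto simp: nrt_iso_rel_def is_iso_def)
  qed
qed

end

theory Submission
  imports Defs
begin

text \<open>Let \<open>X\<close> be the set of right cosets of \<open>H\<close>. In a transversal \<open>S\<close> the left inverse of \<open>y\<close>
  is the element of \<open>S \<inter> H y\<^sup>-\<^sup>1\<close>; as \<open>y\<close> runs through its coset, this coset runs through the whole
  \<open>H\<close>-orbit paired with that of \<open>H y\<close>. So the left inverse map of the loop can be prescribed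
  arbitrarily subject to mapping each \<open>H\<close>-orbit on \<open>X\<close> into the paired orbit, and its isomorphism
  type as a self-map is an invariant of the loop. If the \<open>H\<close>-orbits on \<open>X\<close> exceed singletons by a total
  of at least \<open>2\<close>, counting its image size and its fixed points (or its 2-periodic points)
  yields five classes, except when the only nontrivial orbits are two mutually paired ones of size \<open>2\<close>.
  In that case, and when the only nontrivial orbit has size \<open>2\<close> but \<open>H\<close> fixes a second coset, the
  action of a fixed coset \<open>H z\<close> on the nontrivial orbits separates further loops. What remains is
  \<open>H\<close> normal, with one class, and index \<open>3\<close>, with at most three.\<close>

section \<open>Right cosets and transversals\<close>

locale finite_subgroup = group G for G (structure) +
  fixes H
  assumes finite_G: "finite (carrier G)" and subgroup_H: "subgroup H G"
begin

abbreviation rc :: "'a \<Rightarrow> 'a set" where "rc x \<equiv> H #> x"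

lemma H_carrier [simp]: "h \<in> H \<Longrightarrow> h \<in> carrier G"
  using subgroup.mem_carrier[OF subgroup_H] .

lemma H_closed [simp]: "h \<in> H \<Longrightarrow> k \<in> H \<Longrightarrow> h \<otimes> k \<in> H" "h \<in> H \<Longrightarrow> inv h \<in> H" "\<one> \<in> H"
  using subgroup.m_closed[OF subgroup_H] subgroup.m_inv_closed[OF subgroup_H]
    subgroup.one_closed[OF subgroup_H] by auto

lemma inv_cancel [simp]:
  assumes "x \<in> carrier G" "y \<in> carrier G"
  shows "x \<otimes> (inv x \<otimes> y) = y" "inv x \<otimes> (x \<otimes> y) = y"
  using assms by (simp_all add: m_assoc[symmetric])

lemmas group_norm = m_assoc inv_mult_group

lemma rc_eq_iff:
  assumes "x \<in> carrier G" "y \<in> carrier G"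
  shows "rc x = rc y \<longleftrightarrow> x \<otimes> inv y \<in> H"
proof
  assume "rc x = rc y"
  then have "x \<in> rc y" using rcos_self[OF assms(1) subgroup_H] by simp
  then obtain h where "h \<in> H" "x = h \<otimes> y" by (auto simp: r_coset_def)
  then show "x \<otimes> inv y \<in> H" using assms by (simp add: m_assoc)
next
  assume "x \<otimes> inv y \<in> H"
  then have "x \<in> rc y" using assms
    by (auto simp: r_coset_def m_assoc intro!: bexI[of _ "x \<otimes> inv y"])
  then show "rc x = rc y" using repr_independence[OF _ assms(2) subgroup_H] by simp
qed

lemma rc_mult_left [simp]: "h \<in> H \<Longrightarrow> x \<in> carrier G \<Longrightarrow> rc (h \<otimes> x) = rc x"
  by (simp add: rc_eq_iff m_assoc)

lemma rc_cancel_right [simp]: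
  "x \<in> carrier G \<Longrightarrow> y \<in> carrier G \<Longrightarrow> g \<in> carrier G \<Longrightarrow> rc (x \<otimes> g) = rc (y \<otimes> g) \<longleftrightarrow> rc x = rc y"
  by (simp add: rc_eq_iff group_norm)

lemma rc_mult_cong:
  "rc x = rc y \<Longrightarrow> x \<in> carrier G \<Longrightarrow> y \<in> carrier G \<Longrightarrow> g \<in> carrier G \<Longrightarrow> rc (x \<otimes> g) = rc (y \<otimes> g)"
  by simp

lemma mem_H_iff: "x \<in> carrier G \<Longrightarrow> x \<in> H \<longleftrightarrow> rc x = rc \<one>"
  by (simp add: rc_eq_iff)

text \<open>For elements of a transversal this locates the left inverse of \<open>y\<close> in the
  coset \<open>rc (inv y)\<close>. The map \<open>\<lambda>y. rc (inv y)\<close>, abbreviated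
  \<open>?l\<close> in later proofs, is the left inverse map with values in cosets.\<close>

lemma mult_mem_H_iff:
  "x \<in> carrier G \<Longrightarrow> y \<in> carrier G \<Longrightarrow> x \<otimes> y \<in> H \<longleftrightarrow> rc x = rc (inv y)"
  by (simp add: rc_eq_iff)

lemma rc_eqE:
  assumes "rc x = rc y" "x \<in> carrier G" "y \<in> carrier G"
  obtains h where "h \<in> H" "x = h \<otimes> y"
  using assms that[of "x \<otimes> inv y"] by (simp add: rc_eq_iff m_assoc)

definition index :: nat where "index = card (rcosets H)"

lemma rcosets_eq: "rcosets H = rc ` carrier G"
  by (auto simp: RCOSETS_def)

lemma finite_rcosets: "finite (rcosets H)"
  by (simp add: rcosets_eq finite_G)

text \<open>A coset equals \<open>rc x\<close> for each of its elements \<open>x\<close>, so having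
  one representative per coset amounts to \<open>rc\<close> being a bijection from \<open>S\<close>
  onto the cosets.\<close>

lemma NRT_iff:
  "S \<in> NRT G H \<longleftrightarrow> S \<subseteq> carrier G \<and> \<one> \<in> S \<and> inj_on rc S \<and> rc ` S = rcosets H"
proof -
  have mem: "x \<in> rc g \<longleftrightarrow> rc x = rc g" if "x \<in> carrier G" "g \<in> carrier G" for x g
    using that rcos_self[OF that(1) subgroup_H] repr_independence[OF _ that(2) subgroup_H] by auto
  have "(\<forall>C \<in> rcosets H. \<exists>!x. x \<in> C \<inter> S) \<longleftrightarrow> inj_on rc S \<and> rc ` S = rcosets H"
    if S: "S \<subseteq> carrier G"
  proof
    assume L: "\<forall>C \<in> rcosets H. \<exists>!x. x \<in> C \<inter> S"
    show "inj_on rc S \<and> rc ` S = rcosets H"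
    proof
      show "inj_on rc S"
      proof (rule inj_onI)
        fix x y assume xy: "x \<in> S" "y \<in> S" "rc x = rc y"
        then have "x \<in> rc x \<inter> S" "y \<in> rc x \<inter> S" "rc x \<in> rcosets H"
          using S mem[of x x] mem[of y x] by (auto simp: rcosets_eq)
        then show "x = y" using L by blast
      qed
      show "rc ` S = rcosets H"
      proof
        show "rc ` S \<subseteq> rcosets H" using S by (auto simp: rcosets_eq)
        show "rcosets H \<subseteq> rc ` S"
        proof
          fix C assume C: "C \<in> rcosets H"
          then obtain g where g: "g \<in> carrier G" "C = rc g" by (auto simp: rcosets_eq)
          obtain x where "x \<in> C" "x \<in> S" using L C by blast
          then show "C \<in> rc ` S" using g S mem[of x g] by auto
        qed
      qed
    qed
  next
    assume R: "inj_on rc S \<and> rc ` S = rcosets H"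
    show "\<forall>C \<in> rcosets H. \<exists>!x. x \<in> C \<inter> S"
    proof
      fix C assume "C \<in> rcosets H"
      then obtain x where x: "x \<in> S" "C = rc x" using R by auto
      show "\<exists>!x. x \<in> C \<inter> S"
      proof
        show "x \<in> C \<inter> S" using x S mem[of x x] by auto
        fix y assume "y \<in> C \<inter> S"
        then show "y = x" using x S R mem[of y x] by (auto dest: inj_onD)
      qed
    qed
  qed
  then show ?thesis unfolding NRT_def mem_Collect_eq by (intro conj_cong refl)
qed

lemma NRT_D:
  assumes "S \<in> NRT G H"
  shows NRT_carrier: "\<And>x. x \<in> S \<Longrightarrow> x \<in> carrier G" and NRT_one: "\<one> \<in> S"
    and NRT_inj: "\<And>x y. x \<in> S \<Longrightarrow> y \<in> S \<Longrightarrow> rc x = rc y \<longleftrightarrow> x = y"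
    and NRT_finite: "finite S" and NRT_card: "card S = index"
proof -
  show "\<And>x. x \<in> S \<Longrightarrow> x \<in> carrier G" "\<one> \<in> S" 
    "\<And>x y. x \<in> S \<Longrightarrow> y \<in> S \<Longrightarrow> rc x = rc y \<longleftrightarrow> x = y"
    using assms by (auto simp: NRT_iff inj_on_def)
  show "finite S" using assms finite_G by (auto simp: NRT_iff intro: finite_subset)
  show "card S = index" using assms card_image[of rc S] by (auto simp: NRT_iff index_def)
qed

lemma NRT_rep:
  assumes "S \<in> NRT G H" "g \<in> carrier G"
  obtains x where "x \<in> S" "rc x = rc g"
proof -
  have "rc g \<in> rc ` S" using assms by (auto simp: NRT_iff rcosets_eq)
  then show ?thesis using that by auto
qed

lemma nrt_op:
  assumes "S \<in> NRT G H" "x \<in> S" "y \<in> S"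
  shows "nrt_op G H S x y \<in> S" "rc (nrt_op G H S x y) = rc (x \<otimes> y)"
proof -
  let ?z = "nrt_op G H S x y"
  have "rc (x \<otimes> y) \<inter> S = {?z}" by (rule nrt_op_spec[OF is_group subgroup_H assms])
  then have z: "?z \<in> S" "?z \<in> rc (x \<otimes> y)" by auto
  have "x \<otimes> y \<in> carrier G" using assms NRT_carrier by auto
  then show "rc ?z = rc (x \<otimes> y)" using repr_independence[OF z(2) _ subgroup_H] by simp
  show "?z \<in> S" by fact
qed

lemma nrt_op_eq_iff:
  assumes "S \<in> NRT G H" "x \<in> S" "y \<in> S" "z \<in> S"
  shows "nrt_op G H S x y = z \<longleftrightarrow> rc (x \<otimes> y) = rc z"
  using nrt_op[OF assms(1-3)] NRT_inj[OF assms(1), of "nrt_op G H S x y" z] assms(4) by auto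

text \<open>A product in a transversal is determined by its coset, so isomorphisms can be read as
  statements about cosets. The identity is preserved because \<open>f \<one>\<close> is idempotent
  and right multiplication cancels.\<close>

lemma nrt_iso_relD:
  assumes "(S, T) \<in> nrt_iso_rel G H"
  shows "\<exists>f. bij_betw f S T \<and> f \<one> = \<one> \<and>
    (\<forall>x\<in>S. \<forall>y\<in>S. \<forall>z\<in>S. rc (f x \<otimes> f y) = rc (f z) \<longleftrightarrow> rc (x \<otimes> y) = rc z) \<and>
    (\<forall>x\<in>S. \<forall>y\<in>S. f x \<otimes> f y \<in> H \<longleftrightarrow> x \<otimes> y \<in> H)"
proof -
  have S: "S \<in> NRT G H" and T: "T \<in> NRT G H" using assms by (auto simp: nrt_iso_rel_def)
  obtain f where bij: "bij_betw f S T"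
    and hom: "\<And>x y. x \<in> S \<Longrightarrow> y \<in> S \<Longrightarrow> f (nrt_op G H S x y) = nrt_op G H T (f x) (f y)"
    using assms by (auto simp: nrt_iso_rel_def is_iso_def iso_def hom_def nrt_loop_def)
  have fT: "f x \<in> T" if "x \<in> S" for x using bij that by (auto dest: bij_betwE)
  have inj: "f x = f y \<longleftrightarrow> x = y" if "x \<in> S" "y \<in> S" for x y
    using bij that by (auto simp: bij_betw_def inj_on_def)
  have mult: "rc (f x \<otimes> f y) = rc (f z) \<longleftrightarrow> rc (x \<otimes> y) = rc z" if "x \<in> S" "y \<in> S" "z \<in> S" for x y z
    using nrt_op_eq_iff[OF S that] nrt_op_eq_iff[OF T fT[OF that(1)] fT[OF that(2)] fT[OF that(3)]]
      hom[OF that(1,2)] inj[OF nrt_op(1)[OF S that(1,2)] that(3)] by simp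
  note c [simp] = NRT_carrier[OF S] NRT_carrier[OF T fT] NRT_one[OF S] NRT_one[OF T]
  have one: "f \<one> = \<one>"
  proof -
    have "rc (f \<one> \<otimes> f \<one>) = rc (f \<one>)" by (subst mult) auto
    then have "rc (f \<one> \<otimes> f \<one>) = rc (\<one> \<otimes> f \<one>)" by simp
    then have "rc (f \<one>) = rc \<one>" by (subst (asm) rc_cancel_right) auto
    then show ?thesis using NRT_inj[OF T] fT by auto
  qed
  have "f x \<otimes> f y \<in> H \<longleftrightarrow> x \<otimes> y \<in> H" if "x \<in> S" "y \<in> S" for x y
    using mult[OF that NRT_one[OF S]] that by (simp add: one mem_H_iff)
  then show ?thesis using bij one mult by (intro exI[of _ f]) simp
qed

lemma card_bij_betw_eq:
  assumes "bij_betw f S T" "\<And>x. x \<in> S \<Longrightarrow> q (f x) \<longleftrightarrow> p x"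
  shows "card {x \<in> T. q x} = card {x \<in> S. p x}"
proof -
  have "{x \<in> T. q x} = f ` {x \<in> S. p x}" using assms by (auto simp: bij_betw_def)
  moreover have "inj_on f {x \<in> S. p x}" using assms by (auto simp: bij_betw_def inj_on_def)
  ultimately show ?thesis by (simp add: card_image)
qed

section \<open>Invariants of the loop\<close>

text \<open>For \<open>x, y \<in> S\<close> the loop satisfies \<open>x \<circ> y = \<one>\<close> iff \<open>x \<otimes> y \<in> H\<close>, and \<open>x \<circ> y = z\<close> iff
  \<open>rc (x \<otimes> y) = rc z\<close>; hence the following are invariant under isomorphism although they are written
  in terms of \<open>G\<close>.\<close>

definition rinv_card :: "'a set \<Rightarrow> nat"
  where "rinv_card S = card {x \<in> S. \<exists>y\<in>S. x \<otimes> y \<in> H}"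

text \<open>These are the fixed points of the left inverse map, with \<open>\<one>\<close> among
  them.\<close>

definition square_card :: "'a set \<Rightarrow> nat"
  where "square_card S = card {x \<in> S. x \<otimes> x \<in> H}"

text \<open>These are the points of period at most 2 of the left inverse map.\<close>

definition inverse_card :: "'a set \<Rightarrow> nat"
  where "inverse_card S = card {x \<in> S. \<exists>y\<in>S. x \<otimes> y \<in> H \<and> y \<otimes> x \<in> H}"

text \<open>Asks whether right translation by some involution of the loop has a fixed point. It
  serves the case of index four.\<close>

definition involution_fixes :: "'a set \<Rightarrow> bool"
  where "involution_fixes S \<longleftrightarrow> (\<exists>x\<in>S. \<exists>y\<in>S. y \<noteq> \<one> \<and> y \<otimes> y \<in> H \<and> rc (x \<otimes> y) = rc x)"

text \<open>Here the left inverse map acts as \<open>d \<mapsto> b \<mapsto> c \<mapsto> a\<close>, starting at an element \<open>d\<close> outside its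
  image.\<close>

definition chain_card :: "'a set \<Rightarrow> nat"
  where "chain_card S = card {z \<in> S. \<exists>d\<in>S. \<exists>b\<in>S. \<exists>c\<in>S. \<exists>a\<in>S. (\<forall>y\<in>S. d \<otimes> y \<notin> H) \<and>
    b \<otimes> d \<in> H \<and> c \<otimes> b \<in> H \<and> a \<otimes> c \<in> H \<and> z \<notin> {\<one>, a, b, c, d} \<and>
    (rc (d \<otimes> z) = rc d \<or> rc (d \<otimes> z) = rc b)}"

definition invariants :: "'a set \<Rightarrow> nat \<times> nat \<times> nat \<times> bool \<times> nat"
  where "invariants S =
    (rinv_card S, square_card S, inverse_card S, involution_fixes S, chain_card S)"

lemma invariants_eq:
  assumes "(S, T) \<in> nrt_iso_rel G H"
  shows "invariants S = invariants T"
proof -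
  have S: "S \<in> NRT G H" and T: "T \<in> NRT G H" using assms by (auto simp: nrt_iso_rel_def)
  obtain f where bij: "bij_betw f S T" and one: "f \<one> = \<one>"
    and m: "\<forall>x\<in>S. \<forall>y\<in>S. \<forall>z\<in>S. rc (f x \<otimes> f y) = rc (f z) \<longleftrightarrow> rc (x \<otimes> y) = rc z"
    and h: "\<forall>x\<in>S. \<forall>y\<in>S. f x \<otimes> f y \<in> H \<longleftrightarrow> x \<otimes> y \<in> H"
    using nrt_iso_relD[OF assms] by auto
  have Teq: "T = f ` S" using bij by (simp add: bij_betw_def)
  have inj: "f x = f y \<longleftrightarrow> x = y" if "x \<in> S" "y \<in> S" for x y
    using bij that by (auto simp: bij_betw_def inj_on_def)
  have inj1: "f x = \<one> \<longleftrightarrow> x = \<one>" if "x \<in> S" for x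
    using inj[OF that NRT_one[OF S]] one by simp
  have ex: "(\<exists>y\<in>T. P y) \<longleftrightarrow> (\<exists>y\<in>S. P (f y))" and all: "(\<forall>y\<in>T. P y) \<longleftrightarrow> (\<forall>y\<in>S. P (f y))" for P
    by (auto simp: Teq)
  have "rinv_card T = rinv_card S" unfolding rinv_card_def
    by (rule card_bij_betw_eq[OF bij]) (simp add: ex h cong: bex_cong)
  moreover have "square_card T = square_card S" unfolding square_card_def
    by (rule card_bij_betw_eq[OF bij]) (simp add: h)
  moreover have "inverse_card T = inverse_card S" unfolding inverse_card_def
    by (rule card_bij_betw_eq[OF bij]) (simp add: ex h cong: bex_cong)
  moreover have "involution_fixes T = involution_fixes S" unfolding involution_fixes_def
    by (simp add: ex h m inj1 cong: bex_cong)
  moreover have "chain_card T = chain_card S" unfolding chain_card_def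
    by (rule card_bij_betw_eq[OF bij]) (simp add: ex all h m inj inj1 cong: bex_cong ball_cong)
  ultimately show ?thesis by (simp add: invariants_def)
qed

section \<open>Bounding the number of classes from below by invariants\<close>

lemma finite_NRT: "finite (NRT G H)"
  by (rule finite_subset[of _ "Pow (carrier G)"]) (auto simp: NRT_iff finite_G)

text \<open>The invariants are constant on each class, so evaluating them at a chosen member of
  every class already yields all values.\<close>

lemma card_invariants_le: "card (invariants ` NRT G H) \<le> card (nrt_iso_classes G H)"
proof -
  note e = equiv_nrt_iso_rel[OF is_group subgroup_H]
  let ?g = "\<lambda>C. invariants (SOME S. S \<in> C)"
  have "invariants S \<in> ?g ` nrt_iso_classes G H" if S: "S \<in> NRT G H" for S
  proof
    let ?C = "nrt_iso_rel G H `` {S}"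
    show "?C \<in> nrt_iso_classes G H" using S by (auto simp: nrt_iso_classes_def intro: quotientI)
    have "S \<in> ?C" by (rule equiv_class_self[OF e S])
    then have "(SOME T. T \<in> ?C) \<in> ?C" by (rule someI)
    then have "(S, SOME T. T \<in> ?C) \<in> nrt_iso_rel G H" by simp
    then show "invariants S = ?g ?C" by (rule invariants_eq)
  qed
  then have sub: "invariants ` NRT G H \<subseteq> ?g ` nrt_iso_classes G H" by blast
  have fin: "finite (nrt_iso_classes G H)" unfolding nrt_iso_classes_def
    by (rule finite_quotient[OF finite_NRT]) (use e in \<open>auto simp: equiv_def\<close>)
  show ?thesis using card_mono[OF finite_imageI[OF fin] sub] card_image_le[OF fin, of ?g] by linarith
qed

lemma card_classes_ge:
  assumes "A \<subseteq> invariants ` NRT G H" "card A = k"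
  shows "k \<le> card (nrt_iso_classes G H)"
  using card_mono[OF finite_imageI[OF finite_NRT] assms(1)] card_invariants_le assms(2) by simp

section \<open>Constructing transversals and measuring their left inverse maps\<close>

lemma NRT_extend:
  assumes "K \<subseteq> carrier G" "\<one> \<in> K" "inj_on rc K"
  obtains S where "S \<in> NRT G H" "K \<subseteq> S"
proof -
  \<comment> \<open>\<open>r\<close> selects the prescribed element in a coset represented by
    \<open>K\<close> and an arbitrary one in any other coset.\<close>
  define r where "r = (\<lambda>C. if C \<in> rc ` K then inv_into K rc C else inv_into (carrier G) rc C)"
  have r: "r C \<in> carrier G \<and> rc (r C) = C" if "C \<in> rcosets H" for C
  proof (cases "C \<in> rc ` K")
    case True
    then show ?thesis using assms(1) inv_into_into[OF True] f_inv_into_f[OF True] by (auto simp: r_def)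
  next
    case False
    have "C \<in> rc ` carrier G" using that by (simp add: rcosets_eq)
    then show ?thesis using False inv_into_into[of C rc "carrier G"] f_inv_into_f[of C rc "carrier G"] by (simp add: r_def)
  qed
  have K: "x \<in> r ` (rcosets H)" if "x \<in> K" for x
  proof
    show "x = r (rc x)" using that assms(3) by (simp add: r_def inv_into_f_f)
    show "rc x \<in> rcosets H" using that assms(1) by (auto simp: rcosets_eq)
  qed
  have "rc ` r ` (rcosets H) = (\<lambda>C. C) ` (rcosets H)" unfolding image_image
    by (rule image_cong) (use r in auto)
  moreover have "inj_on rc (r ` (rcosets H))" using r by (auto simp: inj_on_def)
  ultimately have "r ` (rcosets H) \<in> NRT G H" unfolding NRT_iff using r K assms(2) by auto
  then show ?thesis using that K by blast
qed

lemma NRT_exchange: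
  assumes "S \<in> NRT G H" "y \<in> S" "y \<noteq> \<one>" "y' \<in> carrier G" "rc y' = rc y"
  shows "insert y' (S - {y}) \<in> NRT G H"
proof -
  have "rc ` insert y' (S - {y}) = rc ` S" using assms(2,5) by auto
  moreover have "inj_on rc (insert y' (S - {y}))"
    using assms NRT_inj[OF assms(1)] by (auto simp: inj_on_def)
  ultimately show ?thesis using assms by (auto simp: NRT_iff)
qed

text \<open>An element has a right inverse exactly when it is the left inverse of something, and
  \<open>rc\<close> is injective on \<open>S\<close>. So \<open>rinv_card\<close> is the image size
  of the left inverse map, counted in cosets.\<close>

lemma rinv_card_eq:
  assumes "S \<in> NRT G H"
  shows "rinv_card S = card ((\<lambda>y. rc (inv y)) ` S)"
proof -
  note c [simp] = NRT_carrier[OF assms]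
  have "rc ` {x \<in> S. \<exists>y\<in>S. x \<otimes> y \<in> H} = (\<lambda>y. rc (inv y)) ` S"
  proof
    show "rc ` {x \<in> S. \<exists>y\<in>S. x \<otimes> y \<in> H} \<subseteq> (\<lambda>y. rc (inv y)) ` S"
      by (auto simp: mult_mem_H_iff)
    show "(\<lambda>y. rc (inv y)) ` S \<subseteq> rc ` {x \<in> S. \<exists>y\<in>S. x \<otimes> y \<in> H}"
    proof
      fix C assume "C \<in> (\<lambda>y. rc (inv y)) ` S"
      then obtain y where y: "y \<in> S" "C = rc (inv y)" by auto
      obtain x where "x \<in> S" "rc x = rc (inv y)" by (rule NRT_rep[OF assms, of "inv y"]) (use y in auto)
      then show "C \<in> rc ` {x \<in> S. \<exists>y\<in>S. x \<otimes> y \<in> H}"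
        using y by (intro image_eqI[of _ _ x]) (auto simp: mult_mem_H_iff)
    qed
  qed
  moreover have "inj_on rc {x \<in> S. \<exists>y\<in>S. x \<otimes> y \<in> H}"
    using NRT_inj[OF assms] by (auto simp: inj_on_def)
  ultimately show ?thesis
    using card_image[of rc "{x \<in> S. \<exists>y\<in>S. x \<otimes> y \<in> H}"] by (simp add: rinv_card_def)
qed

text \<open>Coincidences among the left inverses of \<open>K\<close> shrink the image, and the
  elements outside \<open>K\<close> add at most one value each.\<close>

lemma rinv_card_le:
  assumes "S \<in> NRT G H" "K \<subseteq> S"
  shows "rinv_card S + card K \<le> index + card ((\<lambda>y. rc (inv y)) ` K)"
proof -
  let ?l = "\<lambda>y. rc (inv y)"
  have fin: "finite S" "finite K" using NRT_finite[OF assms(1)] assms(2) by (auto intro: finite_subset)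
  have "?l ` S = ?l ` K \<union> ?l ` (S - K)" using assms(2) by auto
  then have "rinv_card S \<le> card (?l ` K) + card (?l ` (S - K))"
    unfolding rinv_card_eq[OF assms(1)] by (simp add: card_Un_le)
  moreover have "card (?l ` (S - K)) \<le> card (S - K)" using fin by (simp add: card_image_le)
  moreover have "card (S - K) + card K = index"
    using card_Diff_subset[OF fin(2) assms(2)] card_mono[OF fin(1) assms(2)] NRT_card[OF assms(1)] by simp
  ultimately show ?thesis by linarith
qed

text \<open>Cosets are only compared as points, so equalities between them must not be split by
  extensionality.\<close>

declare equalityI [rule del]

section \<open>Double cosets and the normalizer\<close>

text \<open>The double coset of \<open>w\<close> is the disjoint union of the cosets in the
  \<open>H\<close>-orbit of \<open>rc w\<close>, each with \<open>card H\<close> elements.\<close>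

lemma card_double_coset:
  assumes w: "w \<in> carrier G"
  shows "card H * card ((\<lambda>h. rc (w \<otimes> h)) ` H) = card {h \<otimes> (w \<otimes> k) |h k. h \<in> H \<and> k \<in> H}"
proof -
  let ?A = "(\<lambda>h. rc (w \<otimes> h)) ` H"
  have A: "?A \<subseteq> rcosets H" using w by (auto simp: rcosets_eq)
  have fin: "finite ?A" by (rule finite_subset[OF A finite_rcosets])
  have union: "\<Union> ?A = {h \<otimes> (w \<otimes> k) |h k. h \<in> H \<and> k \<in> H}"
    unfolding r_coset_def by (intro equalityI) blast+
  have H: "H \<subseteq> carrier G" by auto
  have "card H * card ?A = card (\<Union> ?A)"
  proof (rule card_partition[OF fin])
    show "finite (\<Union> ?A)" using w unfolding union by (auto intro: finite_subset[OF _ finite_G])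
    show "card C = card H" if "C \<in> ?A" for C using that A card_rcosets_equal H by auto
    show "C \<inter> D = {}" if "C \<in> ?A" "D \<in> ?A" "C \<noteq> D" for C D
      using that A rcos_disjoint[OF subgroup_H] unfolding pairwise_def disjnt_def by blast
  qed
  then show ?thesis by (simp only: union)
qed

text \<open>Inversion maps the double coset of \<open>w\<close> bijectively onto that of
  \<open>inv w\<close>; hence paired orbits have equal size.\<close>

lemma card_inv_double_coset:
  assumes w: "w \<in> carrier G"
  shows "card ((\<lambda>h. rc (inv w \<otimes> h)) ` H) = card ((\<lambda>h. rc (w \<otimes> h)) ` H)"
proof -
  let ?D = "\<lambda>w. {h \<otimes> (w \<otimes> k) |h k. h \<in> H \<and> k \<in> H}"
  have "m_inv G ` ?D w = ?D (inv w)"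
  proof (rule equalityI)
    show "m_inv G ` ?D w \<subseteq> ?D (inv w)"
    proof
      fix x assume "x \<in> m_inv G ` ?D w"
      then obtain h k where "h \<in> H" "k \<in> H" "x = inv (h \<otimes> (w \<otimes> k))" by auto
      then have "x = inv k \<otimes> (inv w \<otimes> inv h)" "inv k \<in> H" "inv h \<in> H"
        using w by (simp_all add: group_norm)
      then show "x \<in> ?D (inv w)" by blast
    qed
    show "?D (inv w) \<subseteq> m_inv G ` ?D w"
    proof
      fix x assume "x \<in> ?D (inv w)"
      then obtain h k where hk: "h \<in> H" "k \<in> H" "x = h \<otimes> (inv w \<otimes> k)" by auto
      then have "x = inv (inv k \<otimes> (w \<otimes> inv h))" using w by (simp add: group_norm)
      moreover have "inv k \<otimes> (w \<otimes> inv h) \<in> ?D w" using hk H_closed(2) by blast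
      ultimately show "x \<in> m_inv G ` ?D w" by (rule image_eqI)
    qed
  qed
  moreover have "card (m_inv G ` ?D w) = card (?D w)"
    using w by (intro card_image inj_on_inverseI[of _ "m_inv G"]) auto
  ultimately have "card (?D (inv w)) = card (?D w)" by (simp only:)
  then have "card H * card ((\<lambda>h. rc (inv w \<otimes> h)) ` H) = card H * card ((\<lambda>h. rc (w \<otimes> h)) ` H)"
    using card_double_coset w by simp
  moreover have "card H > 0"
    using H_closed(3) by (auto simp: card_gt_0_iff simp del: H_closed intro!: finite_subset[OF _ finite_G])
  ultimately show ?thesis by simp
qed

text \<open>The coset \<open>rc u\<close> is a fixed point of \<open>H\<close>. This says that
  conjugation by \<open>u\<close> maps \<open>H\<close> into itself, so by finiteness
  \<open>u\<close> lies in the normalizer of \<open>H\<close>.\<close>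

definition normalizing :: "'a \<Rightarrow> bool"
  where "normalizing u \<longleftrightarrow> u \<in> carrier G \<and> (\<forall>h\<in>H. rc (u \<otimes> h) = rc u)"

text \<open>The orbit of \<open>rc u\<close> is a singleton, and the paired orbit has the same
  size.\<close>

lemma normalizing_inv:
  assumes "normalizing u"
  shows "normalizing (inv u)"
proof -
  let ?D = "\<lambda>w. (\<lambda>h. rc (w \<otimes> h)) ` H"
  have u: "u \<in> carrier G" "\<And>h. h \<in> H \<Longrightarrow> rc (u \<otimes> h) = rc u"
    using assms by (auto simp: normalizing_def)
  have "?D u = (\<lambda>_. rc u) ` H" by (rule image_cong) (use u in auto)
  also have "\<dots> = {rc u}" using H_closed(3) by (simp only: image_constant)
  finally have "card (?D (inv u)) = 1" using card_inv_double_coset[OF u(1)] by simp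
  then obtain C where C: "?D (inv u) = {C}" by (auto simp: card_1_singleton_iff)
  have "rc (inv u \<otimes> h) = C" if "h \<in> H" for h using C that by blast
  from this this[of \<one>] show ?thesis using u(1) by (simp add: normalizing_def)
qed

lemma normalizing_carrier: "normalizing u \<Longrightarrow> u \<in> carrier G"
  by (simp add: normalizing_def)

text \<open>Left multiplication by a normalizing element is well defined on cosets, and
  \<open>inv u\<close> provides the inverse map.\<close>

lemma rc_cancel_left:
  assumes u: "normalizing u" and xy: "x \<in> carrier G" "y \<in> carrier G"
  shows "rc (u \<otimes> x) = rc (u \<otimes> y) \<longleftrightarrow> rc x = rc y"
proof -
  have *: "rc (v \<otimes> p) = rc (v \<otimes> q)"
    if v: "normalizing v" and pq: "rc p = rc q" "p \<in> carrier G" "q \<in> carrier G" for v p q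
  proof -
    obtain g where g: "g \<in> H" "p = g \<otimes> q" by (rule rc_eqE[OF pq])
    have "rc (v \<otimes> g \<otimes> q) = rc (v \<otimes> q)"
      using v g pq by (subst rc_cancel_right) (auto simp: normalizing_def)
    then show ?thesis using g v pq by (simp add: m_assoc normalizing_carrier)
  qed
  show ?thesis
    using *[of u x y] *[of "inv u" "u \<otimes> x" "u \<otimes> y"] u xy normalizing_inv[OF u] normalizing_carrier[OF u]
    by auto
qed

lemma normalizing_rc:
  assumes "normalizing u" "x \<in> carrier G" "rc x = rc u"
  shows "normalizing x"
proof -
  have "rc (x \<otimes> h) = rc x" if "h \<in> H" for h
  proof -
    have "rc (x \<otimes> h) = rc (u \<otimes> h)" using assms that by (subst rc_cancel_right) (auto simp: normalizing_def)
    then show ?thesis using assms that by (simp add: normalizing_def)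
  qed
  then show ?thesis using assms by (simp add: normalizing_def)
qed

lemma normalizing_mult:
  assumes "normalizing u" "normalizing v"
  shows "normalizing (u \<otimes> v)"
proof -
  have c: "u \<in> carrier G" "v \<in> carrier G" using assms by (auto simp: normalizing_def)
  have "rc (u \<otimes> (v \<otimes> h)) = rc (u \<otimes> v)" if "h \<in> H" for h
    using assms c that by (subst rc_cancel_left) (auto simp: normalizing_def)
  then show ?thesis using c by (simp add: normalizing_def m_assoc)
qed

lemma normalizing_H: "g \<in> H \<Longrightarrow> normalizing g"
  by (simp add: normalizing_def rc_eq_iff)

lemma normalizing_mult_right_iff:
  assumes "x \<in> carrier G" "h \<in> H"
  shows "normalizing (x \<otimes> h) \<longleftrightarrow> normalizing x"
  using normalizing_mult[of "x \<otimes> h" "inv h"] normalizing_mult[of x h]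
    normalizing_H[of h] normalizing_H[of "inv h"] assms by (auto simp: m_assoc)

text \<open>The coset \<open>H\<close> is fixed by \<open>H\<close>, and being fixed is constant
  along an orbit.\<close>

lemma rc_one_moved:
  assumes "x \<in> carrier G" "h \<in> H" "rc (x \<otimes> h) \<noteq> rc x"
  shows "rc x \<noteq> rc \<one>" "rc (x \<otimes> h) \<noteq> rc \<one>"
proof -
  have "\<not> normalizing x" using assms by (auto simp: normalizing_def)
  moreover have "\<not> normalizing (x \<otimes> h)" using calculation assms by (simp add: normalizing_mult_right_iff)
  ultimately show "rc x \<noteq> rc \<one>" "rc (x \<otimes> h) \<noteq> rc \<one>"
    using assms normalizing_rc[OF normalizing_H[OF H_closed(3)]] by auto
qed

section \<open>Changing one representative\<close>

text \<open>If \<open>H w\<close> is not the coset of a left inverse, then by pigeonhole two elements of \<open>S\<close> in the double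
  coset of \<open>w\<^sup>-\<^sup>1\<close> share their left inverse, and one of them can be moved to hit \<open>H w\<close>.\<close>

lemma rinv_card_step:
  assumes S: "S \<in> NRT G H" and K: "K \<subseteq> S" "\<one> \<in> K" "inj_on (\<lambda>y. rc (inv y)) K"
    and less: "rinv_card S < index"
  shows "\<exists>S' \<in> NRT G H. K \<subseteq> S' \<and> rinv_card S' = Suc (rinv_card S)"
proof -
  let ?l = "\<lambda>y. rc (inv y)"
  note c [simp] = NRT_carrier[OF S]
  have "?l ` S \<subseteq> rcosets H" by (auto simp: rcosets_eq)
  moreover have "?l ` S \<noteq> rcosets H" 
    by (rule notI) (use less in \<open>simp add: rinv_card_eq[OF S] index_def\<close>)
  ultimately obtain w where w: "w \<in> carrier G" "rc w \<notin> ?l ` S"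
    unfolding rcosets_eq by (blast intro: equalityI)
  let ?D = "\<lambda>w. (\<lambda>h. rc (w \<otimes> h)) ` H"
  let ?A = "{y \<in> S. rc y \<in> ?D (inv w)}"
  have finD: "finite (?D w)"
    by (rule finite_subset[OF _ finite_rcosets]) (use w in \<open>auto simp: rcosets_eq\<close>)
  have wD: "rc w \<in> ?D w" by (rule image_eqI[of _ _ \<one>]) (use w in auto)
  have "?D (inv w) \<subseteq> rc ` ?A"
  proof
    fix C assume C: "C \<in> ?D (inv w)"
    then obtain h where h: "h \<in> H" "C = rc (inv w \<otimes> h)" by auto
    obtain y where y: "y \<in> S" "rc y = rc (inv w \<otimes> h)"
      by (rule NRT_rep[OF S, of "inv w \<otimes> h"]) (use h w in auto)
    then show "C \<in> rc ` ?A" using C h by (intro image_eqI[of _ _ y]) auto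
  qed
  then have "rc ` ?A = ?D (inv w)" by (intro equalityI) auto
  moreover have "inj_on rc ?A" using NRT_inj[OF S] by (auto simp: inj_on_def)
  \<comment> \<open>\<open>?A\<close> has one element for each coset in the orbit of
    \<open>rc (inv w)\<close>, which is as large as its paired orbit \<open>?D w\<close>.\<close>
  ultimately have cardA: "card ?A = card (?D w)"
    using card_inv_double_coset[OF w(1)] card_image[of rc ?A] by simp
  have "?l ` ?A \<subseteq> ?D w - {rc w}"
  proof
    fix C assume "C \<in> ?l ` ?A"
    then obtain y h where y: "y \<in> S" "C = ?l y" "h \<in> H" "rc y = rc (inv w \<otimes> h)" by auto
    then obtain k where k: "k \<in> H" "y = k \<otimes> (inv w \<otimes> h)"
      using w by (auto elim: rc_eqE)
    then have "C = rc (w \<otimes> inv k)" using y w by (simp add: group_norm)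
    then have "C \<in> ?D w" using k by auto
    moreover have "C \<noteq> rc w" using w(2) y(1,2) by blast
    ultimately show "C \<in> ?D w - {rc w}" by blast
  qed
  then have "card (?l ` ?A) \<le> card (?D w - {rc w})" using finD by (intro card_mono) auto
  also have "\<dots> < card ?A" using card_Diff1_less[OF finD wD] by (simp only: cardA)
  finally have "\<not> inj_on ?l ?A" by (auto dest: card_image)
  then obtain y1 y2 where y12: "y1 \<in> ?A" "y2 \<in> ?A" "y1 \<noteq> y2" "?l y1 = ?l y2"
    unfolding inj_on_def by blast
  \<comment> \<open>Since \<open>?l\<close> is injective on \<open>K\<close>, one of the two
    colliding elements lies outside \<open>K\<close> and may be replaced.\<close>
  obtain y z where y: "y \<in> ?A" "y \<notin> K" "z \<in> ?A" "z \<noteq> y" "?l y = ?l z"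
  proof (cases "y1 \<in> K")
    case True
    then have "y2 \<notin> K" using y12 K(3) by (auto dest: inj_onD)
    then show ?thesis using that[of y2 y1] y12 by auto
  qed (use that[of y1 y2] y12 in auto)
  obtain h where h: "h \<in> H" "rc y = rc (inv w \<otimes> h)" using y by auto
  \<comment> \<open>\<open>?y\<close> lies in the coset of \<open>y\<close> and has left inverse
    coset \<open>rc w\<close>, while \<open>z\<close> still supplies the value that \<open>y\<close>
    had.\<close>
  let ?y = "inv w \<otimes> h"
  let ?S = "insert ?y (S - {y})"
  have S': "?S \<in> NRT G H" by (rule NRT_exchange[OF S]) (use y h w K(2) in auto)
  have "?l ?y = rc w" using h w by (simp add: group_norm)
  moreover have "?l ` (S - {y}) = ?l ` S" using y by (intro equalityI) auto
  ultimately have "?l ` ?S = insert (rc w) (?l ` S)" by simp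
  then have "rinv_card ?S = Suc (rinv_card S)"
    by (simp only: rinv_card_eq[OF S] rinv_card_eq[OF S']
        card_insert_disjoint[OF finite_imageI[OF NRT_finite[OF S]] w(2)])
  moreover have "K \<subseteq> ?S" using K(1) y(2) by blast
  ultimately show ?thesis using S' by blast
qed

text \<open>Each step raises the image size by exactly one and keeps \<open>K\<close>, so no
  intermediate size is skipped.\<close>

lemma rinv_card_levels:
  assumes S: "S \<in> NRT G H" and K: "K \<subseteq> S" "\<one> \<in> K" "inj_on (\<lambda>y. rc (inv y)) K"
    and j: "rinv_card S \<le> j" "j \<le> index"
  shows "\<exists>T \<in> NRT G H. K \<subseteq> T \<and> rinv_card T = j"
  using j
proof (induction j rule: dec_induct)
  case base
  then show ?case using S K by blast
next
  case (step j)
  then obtain T where "T \<in> NRT G H" "K \<subseteq> T" "rinv_card T = j" by auto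
  then show ?case using rinv_card_step[of T K] K step by auto
qed

lemma five_classes:
  assumes "{T1, T2, T3, T4, T5} \<subseteq> NRT G H"
    "distinct [invariants T1, invariants T2, invariants T3, invariants T4, invariants T5]"
  shows "5 \<le> card (nrt_iso_classes G H)"
proof (rule card_classes_ge)
  let ?L = "[invariants T1, invariants T2, invariants T3, invariants T4, invariants T5]"
  show "set ?L \<subseteq> invariants ` NRT G H" using assms(1) by auto
  show "card (set ?L) = 5" unfolding distinct_card[OF assms(2)] by simp
qed

section \<open>A self-paired orbit\<close>

text \<open>In \<open>S\<close> both \<open>a\<close> and \<open>h\<^sup>-\<^sup>1 a h\<close> are their own left inverses; the new representatives of their
  cosets are left inverses of each other.\<close>

lemma swap_squares:
  assumes a: "a \<in> carrier G" "a \<otimes> a \<in> H" and h: "h \<in> H" "rc (a \<otimes> h) \<noteq> rc a"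
    and S: "S \<in> NRT G H" "a \<in> S" "inv h \<otimes> (a \<otimes> h) \<in> S"
  defines "S' \<equiv> insert (inv h \<otimes> a) (insert (a \<otimes> h) (S - {a, inv h \<otimes> (a \<otimes> h)}))"
  shows "S' \<in> NRT G H" "rinv_card S' = rinv_card S" "square_card S' < square_card S"
proof -
  let ?l = "\<lambda>y. rc (inv y)"
  let ?b = "inv h \<otimes> (a \<otimes> h)" and ?a' = "inv h \<otimes> a" and ?b' = "a \<otimes> h"
  have ra: "rc (inv a) = rc a" using a by (simp add: mult_mem_H_iff)
  have rb: "rc ?b = rc ?b'" "rc ?b \<noteq> rc a" using a h by auto
  have ab: "?b \<noteq> a" using rb(2) by metis
  have a1: "a \<noteq> \<one>" and b1: "?b \<noteq> \<one>" using rc_one_moved[OF a(1) h] rb by metis+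
  have "insert ?b' (S - {?b}) \<in> NRT G H" using a h S b1 by (intro NRT_exchange) auto
  then have "insert ?a' (insert ?b' (S - {?b}) - {a}) \<in> NRT G H"
    using a h S rb a1 ab b1 by (intro NRT_exchange) auto
  moreover have "insert ?b' (S - {?b}) - {a} = insert ?b' (S - {a, ?b})"
    using h(2) by (intro equalityI) auto
  ultimately show S': "S' \<in> NRT G H" by (simp add: S'_def)
  have la: "?l ?a' = ?l ?b" using a h by (simp add: group_norm)
  have lb: "?l ?b' = ?l a" using a h by (simp add: group_norm)
  have "?l ` S' = ?l ` S" unfolding S'_def using la lb S by (intro equalityI) (auto simp del: inv_mult_group)
  then show "rinv_card S' = rinv_card S" using rinv_card_eq S(1) S' by simp
  have "?a' \<otimes> ?a' \<notin> H"
  proof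
    assume "?a' \<otimes> ?a' \<in> H"
    then have "rc a = rc (inv a \<otimes> h)" using a h by (simp add: mult_mem_H_iff inv_mult_group)
    also have "\<dots> = rc (a \<otimes> h)" using ra a h by simp
    finally show False using h by simp
  qed
  moreover have "?b' \<otimes> ?b' \<notin> H"
  proof
    assume "?b' \<otimes> ?b' \<in> H"
    then have "rc (a \<otimes> h) = rc (inv a)" using a h by (simp add: mult_mem_H_iff inv_mult_group)
    then show False using ra h by simp
  qed
  \<comment> \<open>Neither new representative squares into \<open>H\<close>, so no fixed point is
    gained and \<open>a\<close> is lost.\<close>
  ultimately have "{x \<in> S'. x \<otimes> x \<in> H} \<subseteq> {x \<in> S. x \<otimes> x \<in> H} - {a}" by (auto simp: S'_def)
  moreover have "a \<in> {x \<in> S. x \<otimes> x \<in> H}" using a S by auto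
  ultimately have "{x \<in> S'. x \<otimes> x \<in> H} \<subset> {x \<in> S. x \<otimes> x \<in> H}" by blast
  then show "square_card S' < square_card S"
    unfolding square_card_def using NRT_finite[OF S(1)] by (intro psubset_card_mono) auto
qed

text \<open>The further moved coset \<open>rc c\<close> allows image sizes \<open>index\<close>,
  \<open>index - 1\<close> and \<open>index - 2\<close>. At each of the first two,
  \<open>swap_squares\<close> yields a second loop with fewer fixed points.\<close>

lemma five_classes_involution:
  assumes a: "a \<in> carrier G" "a \<otimes> a \<in> H" and h: "h \<in> H" "rc (a \<otimes> h) \<noteq> rc a"
    and c: "c \<in> carrier G" "k \<in> H" "rc (c \<otimes> k) \<noteq> rc c" "rc c \<noteq> rc a" "rc c \<noteq> rc (a \<otimes> h)"
  shows "5 \<le> card (nrt_iso_classes G H)"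
proof -
  let ?l = "\<lambda>y. rc (inv y)" and ?b = "inv h \<otimes> (a \<otimes> h)"
  have hc [simp]: "h \<in> carrier G" "k \<in> carrier G" using h c by auto
  have ra: "rc (inv a) = rc a" using a by (simp add: mult_mem_H_iff)
  have r1: "rc a \<noteq> rc \<one>" "rc c \<noteq> rc \<one>" "rc (a \<otimes> h) \<noteq> rc \<one>" "rc (c \<otimes> k) \<noteq> rc \<one>"
    using rc_one_moved[OF a(1) h] rc_one_moved[OF c(1-3)] by auto
  have l: "?l \<one> = rc \<one>" "?l a = rc a" "?l ?b = rc (a \<otimes> h)"
    using a h ra by (simp_all add: group_norm)
  have injb: "inj_on ?l {\<one>, a, ?b}" using r1 h l by (auto simp: inj_on_def)
  \<comment> \<open>\<open>S1\<close> loses a left inverse while keeping \<open>a\<close> and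
    \<open>?b\<close> for the later swap; \<open>S2\<close> loses two.\<close>
  have "\<exists>S1 \<in> NRT G H. \<exists>S2 \<in> NRT G H. {\<one>, a, ?b} \<subseteq> S1 \<and> rinv_card S1 + 1 \<le> index \<and> rinv_card S2 + 2 \<le> index"
  proof (cases "\<exists>g\<in>H. rc c = rc (a \<otimes> g)")
    case True
    \<comment> \<open>Here \<open>rc c\<close> lies in the orbit of \<open>rc a\<close>: the
      representatives \<open>a\<close>, \<open>a \<otimes> h\<close> and
      \<open>a \<otimes> g\<close> all have the same left inverse.\<close>
    then obtain g where g: "g \<in> H" "rc c = rc (a \<otimes> g)" by auto
    let ?c = "a \<otimes> g"
    have lc: "?l ?c = ?l a" "?l (a \<otimes> h) = ?l a" using a g h by (simp_all add: group_norm)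
    have ne: "a \<noteq> ?c" "a \<noteq> a \<otimes> h" "a \<otimes> h \<noteq> ?c" using c h g by auto
    obtain S1 where S1: "S1 \<in> NRT G H" "{\<one>, a, ?b, ?c} \<subseteq> S1"
      by (rule NRT_extend[of "{\<one>, a, ?b, ?c}"]) (use a h g c r1 in \<open>auto simp: inj_on_def\<close>)
    obtain S2 where S2: "S2 \<in> NRT G H" "{\<one>, a, a \<otimes> h, ?c} \<subseteq> S2"
      by (rule NRT_extend[of "{\<one>, a, a \<otimes> h, ?c}"]) (use a h g c r1 in \<open>auto simp: inj_on_def\<close>)
    have "?l ` {a, ?c} = {?l a}" "?l ` {a, a \<otimes> h, ?c} = {?l a}" using lc by auto
    then show ?thesis using S1 S2 ne rinv_card_le[of S1 "{a, ?c}"] rinv_card_le[of S2 "{a, a \<otimes> h, ?c}"]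
      by (intro bexI[of _ S1] bexI[of _ S2]) auto
  next
    case False
    \<comment> \<open>Here \<open>rc c\<close> has an orbit of its own, and \<open>c\<close>
      collides with \<open>c \<otimes> k\<close> independently of the collision of \<open>a\<close>
      with \<open>a \<otimes> h\<close>.\<close>
    let ?c = "c \<otimes> k"
    have ck: "rc ?c \<noteq> rc (a \<otimes> g)" if g: "g \<in> H" for g
    proof
      assume "rc ?c = rc (a \<otimes> g)"
      then have "rc (?c \<otimes> inv k) = rc (a \<otimes> g \<otimes> inv k)" using a c g by (subst rc_cancel_right) auto
      then have "rc c = rc (a \<otimes> (g \<otimes> inv k))" using a c g by (simp add: m_assoc)
      then show False using False g c by auto
    qed
    have ck': "rc ?c \<noteq> rc a" "rc ?c \<noteq> rc (a \<otimes> h)" using ck[of \<one>] ck[of h] a h by auto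
    have lc: "?l ?c = ?l c" "?l (a \<otimes> h) = ?l a" using a c h by (simp_all add: group_norm)
    have ne: "c \<noteq> ?c" "a \<noteq> a \<otimes> h" "a \<noteq> c" "a \<noteq> ?c" "a \<otimes> h \<noteq> c" "a \<otimes> h \<noteq> ?c"
      using c h ck' by auto
    obtain S1 where S1: "S1 \<in> NRT G H" "{\<one>, a, ?b, c, ?c} \<subseteq> S1"
      by (rule NRT_extend[of "{\<one>, a, ?b, c, ?c}"]) (use a h c r1 ck' in \<open>auto simp: inj_on_def\<close>)
    obtain S2 where S2: "S2 \<in> NRT G H" "{\<one>, a, a \<otimes> h, c, ?c} \<subseteq> S2"
      by (rule NRT_extend[of "{\<one>, a, a \<otimes> h, c, ?c}"]) (use a h c r1 ck' in \<open>auto simp: inj_on_def\<close>)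
    have "?l ` {c, ?c} = {?l c}" "?l ` {a, a \<otimes> h, c, ?c} = {?l a, ?l c}" using lc by auto
    moreover have "card {?l a, ?l c} \<le> 2" by (simp add: card_insert_if)
    ultimately show ?thesis
      using S1 S2 ne rinv_card_le[of S1 "{c, ?c}"] rinv_card_le[of S2 "{a, a \<otimes> h, c, ?c}"]
      by (intro bexI[of _ S1] bexI[of _ S2]) auto
  qed
  then obtain S1 S2 where S1: "S1 \<in> NRT G H" "{\<one>, a, ?b} \<subseteq> S1" "rinv_card S1 + 1 \<le> index"
    and S2: "S2 \<in> NRT G H" "rinv_card S2 + 2 \<le> index" by blast
  \<comment> \<open>The bound on \<open>S2\<close> makes \<open>index\<close> at least 2, so the
    truncated differences are genuine and the three levels distinct.\<close>
  have le: "rinv_card S1 \<le> index" "rinv_card S1 \<le> index - 1" "rinv_card S2 \<le> index - 2"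
    using S1(3) S2(2) by linarith+
  obtain T1 where T1: "T1 \<in> NRT G H" "{\<one>, a, ?b} \<subseteq> T1" "rinv_card T1 = index"
    using rinv_card_levels[OF S1(1,2) _ injb, of index] le by auto
  obtain T2 where T2: "T2 \<in> NRT G H" "{\<one>, a, ?b} \<subseteq> T2" "rinv_card T2 = index - 1"
    using rinv_card_levels[OF S1(1,2) _ injb, of "index - 1"] le by auto
  obtain T3 where T3: "T3 \<in> NRT G H" "rinv_card T3 = index - 2"
    using rinv_card_levels[OF S2(1), of "{\<one>}" "index - 2"] le NRT_one[OF S2(1)] by auto
  obtain T1' where T1': "T1' \<in> NRT G H" "rinv_card T1' = index" "square_card T1' < square_card T1"
    using swap_squares[OF a h T1(1)] T1 by auto
  obtain T2' where T2': "T2' \<in> NRT G H" "rinv_card T2' = index - 1" "square_card T2' < square_card T2"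
    using swap_squares[OF a h T2(1)] T2 by auto
  show ?thesis
    by (rule five_classes[of T1 T1' T2 T2' T3]) (use T1 T2 T3 T1' T2' S2 in \<open>auto simp: invariants_def\<close>)
qed

section \<open>At most three classes\<close>

lemma nrt_isoI:
  assumes S: "S \<in> NRT G H" and T: "T \<in> NRT G H" and bij: "bij_betw f S T"
    and m: "\<And>x y z. x \<in> S \<Longrightarrow> y \<in> S \<Longrightarrow> z \<in> S \<Longrightarrow> rc (x \<otimes> y) = rc z \<Longrightarrow> rc (f x \<otimes> f y) = rc (f z)"
  shows "(S, T) \<in> nrt_iso_rel G H"
proof -
  have fT: "f x \<in> T" if "x \<in> S" for x using bij that by (auto dest: bij_betwE)
  have "f (nrt_op G H S x y) = nrt_op G H T (f x) (f y)" if xy: "x \<in> S" "y \<in> S" for x y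
    using nrt_op_eq_iff[OF T fT[OF xy(1)] fT[OF xy(2)] fT[OF nrt_op(1)[OF S xy]]]
      m[OF xy nrt_op(1)[OF S xy]] nrt_op(2)[OF S xy] by simp
  then have "f \<in> iso (nrt_loop G H S) (nrt_loop G H T)"
    using bij fT by (auto simp: iso_def hom_def nrt_loop_def)
  then show ?thesis using S T by (auto simp: nrt_iso_rel_def is_iso_def)
qed

text \<open>A map \<open>g\<close> whose equal values force isomorphism determines the class: any
  transversal with the given value represents it.\<close>

lemma card_classes_le:
  assumes fin: "finite B" and g: "g ` NRT G H \<subseteq> B"
    and iso: "\<And>S T. S \<in> NRT G H \<Longrightarrow> T \<in> NRT G H \<Longrightarrow> g S = g T \<Longrightarrow> (S, T) \<in> nrt_iso_rel G H"
  shows "card (nrt_iso_classes G H) \<le> card B"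
proof -
  let ?f = "\<lambda>v. nrt_iso_rel G H `` {SOME S. S \<in> NRT G H \<and> g S = v}"
  have "nrt_iso_classes G H \<subseteq> ?f ` B"
  proof
    fix C assume "C \<in> nrt_iso_classes G H"
    then obtain S where S: "S \<in> NRT G H" "C = nrt_iso_rel G H `` {S}"
      by (auto simp: nrt_iso_classes_def elim: quotientE)
    define T where "T = (SOME T. T \<in> NRT G H \<and> g T = g S)"
    have "T \<in> NRT G H \<and> g T = g S" unfolding T_def by (rule someI[of _ S]) (use S in auto)
    then have "(S, T) \<in> nrt_iso_rel G H" using iso S by simp
    then have "C = nrt_iso_rel G H `` {T}"
      using S equiv_class_eq[OF equiv_nrt_iso_rel[OF is_group subgroup_H]] by simp
    then show "C \<in> ?f ` B" using g S by (intro image_eqI[of _ _ "g S"]) (auto simp: T_def)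
  qed
  then show ?thesis using surj_card_le[OF fin] by simp
qed

text \<open>Here \<open>H\<close> is normal, multiplication of cosets is well defined, and every
  transversal is a copy of the quotient group. The isomorphism matches representatives of the same
  coset.\<close>

lemma card_classes_normal:
  assumes "\<And>u. u \<in> carrier G \<Longrightarrow> normalizing u"
  shows "card (nrt_iso_classes G H) \<le> 1"
proof -
  have "(S, T) \<in> nrt_iso_rel G H" if S: "S \<in> NRT G H" and T: "T \<in> NRT G H" for S T
  proof -
    define f where "f x = (SOME y. y \<in> T \<and> rc y = rc x)" for x
    have f: "f x \<in> T \<and> rc (f x) = rc x" if x: "x \<in> S" for x
    proof -
      obtain y where "y \<in> T" "rc y = rc x"
        by (rule NRT_rep[OF T, of x]) (use x NRT_carrier[OF S] in auto)
      then show ?thesis using someI[of "\<lambda>y. y \<in> T \<and> rc y = rc x" y] by (simp add: f_def)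
    qed
    have "bij_betw f S T"
    proof (rule bij_betw_imageI)
      show "inj_on f S" using f NRT_inj[OF S] by (metis inj_onI)
      show "f ` S = T"
      proof (rule equalityI)
        show "T \<subseteq> f ` S"
        proof
          fix y assume y: "y \<in> T"
          obtain x where x: "x \<in> S" "rc x = rc y"
            by (rule NRT_rep[OF S NRT_carrier[OF T y]])
          then have "rc y = rc (f x)" "f x \<in> T" using f[of x] by simp_all
          then have "y = f x" using NRT_inj[OF T y] by blast
          then show "y \<in> f ` S" using x by simp
        qed
      qed (use f in auto)
    qed
    then show ?thesis
    proof (rule nrt_isoI[OF S T])
      fix x y z assume xyz: "x \<in> S" "y \<in> S" "z \<in> S" "rc (x \<otimes> y) = rc z"
      note c [simp] = NRT_carrier[OF S] NRT_carrier[OF T]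
      have "rc (f x \<otimes> f y) = rc (x \<otimes> f y)" using xyz f by (subst rc_cancel_right) auto
      also have "\<dots> = rc (x \<otimes> y)" using xyz f assms by (subst rc_cancel_left) auto
      finally show "rc (f x \<otimes> f y) = rc (f z)" using xyz f by simp
    qed
  qed
  then have "card (nrt_iso_classes G H) \<le> card {()}" by (intro card_classes_le[where g = "\<lambda>_. ()"]) auto
  then show ?thesis by simp
qed

text \<open>Right multiplication by \<open>x\<close> permutes the three cosets and sends
  \<open>rc \<one>\<close> to \<open>rc x\<close>. The two remaining products thus take the two
  remaining values, and whether \<open>x\<close> squares into \<open>H\<close> decides the
  order.\<close>

lemma three_table:
  assumes S: "S \<in> NRT G H" "S = {\<one>, x, y}" "x \<noteq> \<one>" "y \<noteq> \<one>" "x \<noteq> y"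
  shows "rc (x \<otimes> x) = (if x \<otimes> x \<in> H then rc \<one> else rc y)"
    "rc (y \<otimes> x) = (if x \<otimes> x \<in> H then rc y else rc \<one>)"
proof -
  have c: "x \<in> carrier G" "y \<in> carrier G" using NRT_carrier[OF S(1)] S(2) by auto
  have n: "rc x \<noteq> rc \<one>" "rc y \<noteq> rc \<one>" "rc x \<noteq> rc y" using NRT_inj[OF S(1)] S by auto
  have r: "rc g = rc \<one> \<or> rc g = rc x \<or> rc g = rc y" if "g \<in> carrier G" for g
    using NRT_rep[OF S(1) that] S(2) by (metis empty_iff insert_iff)
  have "rc (x \<otimes> x) \<noteq> rc (\<one> \<otimes> x)" "rc (y \<otimes> x) \<noteq> rc (\<one> \<otimes> x)" "rc (y \<otimes> x) \<noteq> rc (x \<otimes> x)"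
    using c n by (subst rc_cancel_right; simp)+
  then have "rc (x \<otimes> x) \<noteq> rc x" "rc (y \<otimes> x) \<noteq> rc x" "rc (y \<otimes> x) \<noteq> rc (x \<otimes> x)" using c by (simp_all del: rc_cancel_right)
  then show "rc (x \<otimes> x) = (if x \<otimes> x \<in> H then rc \<one> else rc y)"
    "rc (y \<otimes> x) = (if x \<otimes> x \<in> H then rc y else rc \<one>)"
    using r[of "x \<otimes> x"] r[of "y \<otimes> x"] c n mem_H_iff[of "x \<otimes> x"]
    by (auto simp del: rc_cancel_right)
qed

text \<open>By \<open>three_table\<close>, applied to \<open>x\<close> and to \<open>y\<close>, the
  two conditions on squares determine the whole multiplication table.\<close>

lemma three_iso:
  assumes S: "S \<in> NRT G H" "S = {\<one>, x, y}" "x \<noteq> \<one>" "y \<noteq> \<one>" "x \<noteq> y"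
    and T: "T \<in> NRT G H" "T = {\<one>, x', y'}" "x' \<noteq> \<one>" "y' \<noteq> \<one>" "x' \<noteq> y'"
    and sq: "x \<otimes> x \<in> H \<longleftrightarrow> x' \<otimes> x' \<in> H" "y \<otimes> y \<in> H \<longleftrightarrow> y' \<otimes> y' \<in> H"
  shows "(S, T) \<in> nrt_iso_rel G H"
proof -
  define f where "f g = (if g = x then x' else if g = y then y' else \<one>)" for g
  have f: "f \<one> = \<one>" "f x = x'" "f y = y'" using S by (auto simp: f_def)
  have c: "x \<in> carrier G" "y \<in> carrier G" "x' \<in> carrier G" "y' \<in> carrier G"
    using NRT_carrier[OF S(1)] S(2) NRT_carrier[OF T(1)] T(2) by auto
  have n: "rc x \<noteq> rc \<one>" "rc y \<noteq> rc \<one>" "rc x \<noteq> rc y"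
    using NRT_inj[OF S(1)] S by auto
  have S': "S = {\<one>, y, x}" and T': "T = {\<one>, y', x'}"
    using S(2) T(2) insert_commute[of x y "{}"] insert_commute[of x' y' "{}"] by simp_all
  note table = three_table[OF S] three_table[OF S(1) S' S(4,3) S(5)[symmetric]]
    three_table[OF T] three_table[OF T(1) T' T(4,3) T(5)[symmetric]]
  have "bij_betw f S T" using f S T by (auto simp: bij_betw_def inj_on_def)
  then show ?thesis
  proof (rule nrt_isoI[OF S(1) T(1)])
    fix u v w assume uvw: "u \<in> S" "v \<in> S" "w \<in> S" "rc (u \<otimes> v) = rc w"
    have u: "u = \<one> \<or> u = x \<or> u = y" and v: "v = \<one> \<or> v = x \<or> v = y" and w: "w = \<one> \<or> w = x \<or> w = y"
      using uvw S(2) by auto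
    show "rc (f u \<otimes> f v) = rc (f w)"
      using u v w uvw(4) f c n sq table
      by (elim disjE) (simp_all split: if_splits)
  qed
qed

text \<open>The number of elements squaring into \<open>H\<close>, which is 1, 2 or 3, is a complete
  invariant.\<close>

lemma card_classes_index_3:
  assumes i: "index = 3"
  shows "card (nrt_iso_classes G H) \<le> 3"
proof -
  have three: "\<exists>x y. S = {\<one>, x, y} \<and> x \<noteq> \<one> \<and> y \<noteq> \<one> \<and> x \<noteq> y" if S: "S \<in> NRT G H" for S
  proof -
    have "card (S - {\<one>}) = 2" using NRT_card[OF S] NRT_one[OF S] NRT_finite[OF S] i by simp
    then obtain x y where xy: "S - {\<one>} = {x, y}" "x \<noteq> y" unfolding card_2_iff by blast
    have "S = {\<one>, x, y}" using insert_Diff[OF NRT_one[OF S]] xy by simp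
    moreover have "x \<in> S - {\<one>}" "y \<in> S - {\<one>}" using xy by simp_all
    ultimately show ?thesis using xy by blast
  qed
  have sq: "square_card {\<one>, x, y} = 1 + of_bool (x \<otimes> x \<in> H) + of_bool (y \<otimes> y \<in> H)"
    if "x \<noteq> \<one>" "y \<noteq> \<one>" "x \<noteq> y" for x y
  proof -
    have "{g \<in> {\<one>, x, y}. g \<otimes> g \<in> H} =
      insert \<one> ((if x \<otimes> x \<in> H then {x} else {}) \<union> (if y \<otimes> y \<in> H then {y} else {}))"
      by (intro equalityI) auto
    then show ?thesis using that unfolding square_card_def by auto
  qed
  have "card (nrt_iso_classes G H) \<le> card {1..3::nat}"
  proof (rule card_classes_le)
    show "square_card ` NRT G H \<subseteq> {1..3}"
    proof
      fix k assume "k \<in> square_card ` NRT G H"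
      then obtain S x y where "k = square_card {\<one>, x, y}" "x \<noteq> \<one>" "y \<noteq> \<one>" "x \<noteq> y" using three by blast
      then show "k \<in> {1..3}" using sq[of x y] by (auto simp: of_bool_def)
    qed
  next
    fix S T assume S: "S \<in> NRT G H" and T: "T \<in> NRT G H" and e: "square_card S = square_card T"
    obtain x y where x: "S = {\<one>, x, y}" "x \<noteq> \<one>" "y \<noteq> \<one>" "x \<noteq> y" using three[OF S] by blast
    obtain x' y' where x': "T = {\<one>, x', y'}" "x' \<noteq> \<one>" "y' \<noteq> \<one>" "x' \<noteq> y'" using three[OF T] by blast
    have T': "T = {\<one>, y', x'}" using x'(1) insert_commute[of x' y' "{}"] by simp
    have "of_bool (x \<otimes> x \<in> H) + of_bool (y \<otimes> y \<in> H) =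
      (of_bool (x' \<otimes> x' \<in> H) + of_bool (y' \<otimes> y' \<in> H) :: nat)"
      using e sq[OF x(2-4)] sq[OF x'(2-4)] x(1) x'(1) by simp
    \<comment> \<open>Equal counts make the two pairs of truth values agree up to order; the other
      order is absorbed by exchanging \<open>x'\<close> and \<open>y'\<close>.\<close>
    then have "((x \<otimes> x \<in> H \<longleftrightarrow> x' \<otimes> x' \<in> H) \<and> (y \<otimes> y \<in> H \<longleftrightarrow> y' \<otimes> y' \<in> H)) \<or>
      ((x \<otimes> x \<in> H \<longleftrightarrow> y' \<otimes> y' \<in> H) \<and> (y \<otimes> y \<in> H \<longleftrightarrow> x' \<otimes> x' \<in> H))"
      by (auto simp: of_bool_def split: if_splits)
    then show "(S, T) \<in> nrt_iso_rel G H"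
      using three_iso[OF S x T x'] three_iso[OF S x T T' x'(3,2) x'(4)[symmetric]] by auto
  qed auto
  then show ?thesis by simp
qed

section \<open>Index four\<close>

text \<open>The cosets turn out to be those of \<open>\<one>\<close>, \<open>z\<close>,
  \<open>a\<close> and \<open>a \<otimes> h\<close>. One loop has only fixed points under left
  inversion, and two further types are each split by \<open>involution_fixes\<close>, which depends
  on the representative chosen in \<open>rc z\<close>.\<close>

lemma five_classes_index_4:
  assumes a: "a \<in> carrier G" "a \<otimes> a \<in> H" and h: "h \<in> H" "rc (a \<otimes> h) \<noteq> rc a"
    and z: "normalizing z" "z \<notin> H"
    and all: "\<And>c. c \<in> carrier G \<Longrightarrow> \<not> normalizing c \<Longrightarrow> rc c = rc a \<or> rc c = rc (a \<otimes> h)"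
  shows "5 \<le> card (nrt_iso_classes G H)"
proof -
  let ?l = "\<lambda>y. rc (inv y)" and ?b = "inv h \<otimes> (a \<otimes> h)"
  have c [simp]: "h \<in> carrier G" "z \<in> carrier G" using h z by (auto simp: normalizing_def)
  have na: "\<not> normalizing a" using h by (auto simp: normalizing_def)
  then have nah: "\<not> normalizing (a \<otimes> h)" using a h by (simp add: normalizing_mult_right_iff)
  have za: "rc z \<noteq> rc \<one>" "rc z \<noteq> rc a" "rc z \<noteq> rc (a \<otimes> h)"
    using z na nah a normalizing_rc[OF z(1)] by (auto simp: mem_H_iff)
  have r1: "rc a \<noteq> rc \<one>" "rc (a \<otimes> h) \<noteq> rc \<one>" using rc_one_moved[OF a(1) h] by auto
  \<comment> \<open>\<open>rc (y \<otimes> a)\<close> is a moved coset different from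
    \<open>rc a\<close>, so only one is left. Cancelling \<open>a\<close> then shows that
    \<open>rc z\<close> is the only fixed coset besides \<open>H\<close>.\<close>
  have shift: "rc (y \<otimes> a) = rc (a \<otimes> h)" if y: "normalizing y" "y \<notin> H" for y
  proof -
    have cy: "y \<in> carrier G" using y by (simp add: normalizing_carrier)
    have "\<not> normalizing (y \<otimes> a)"
      using normalizing_mult[OF normalizing_inv[OF y(1)], of "y \<otimes> a"] na cy a by auto
    moreover have "rc (y \<otimes> a) \<noteq> rc (\<one> \<otimes> a)"
      using y cy a by (subst rc_cancel_right) (auto simp: mem_H_iff)
    ultimately show ?thesis using all[of "y \<otimes> a"] a cy by auto
  qed
  have four: "rc x = rc \<one> \<or> rc x = rc z \<or> rc x = rc a \<or> rc x = rc (a \<otimes> h)"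
    if x: "x \<in> carrier G" for x
  proof (cases "normalizing x \<and> x \<notin> H")
    case True
    then have "rc (x \<otimes> a) = rc (z \<otimes> a)" using shift[of x] shift[OF z] by simp
    then show ?thesis using x a by simp
  next
    case False
    then show ?thesis using all[OF x] x by (auto simp: mem_H_iff)
  qed
  have zz: "rc (z \<otimes> z) = rc \<one>"
  proof -
    have n: "normalizing (z \<otimes> z)" using normalizing_mult z by simp
    have "rc (z \<otimes> z) \<noteq> rc (\<one> \<otimes> z)" using za by (subst rc_cancel_right) auto
    then show ?thesis
      using four[of "z \<otimes> z"] normalizing_rc[OF n a(1)] normalizing_rc[OF n, of "a \<otimes> h"] na nah a by auto
  qed
  have NRT4: "{\<one>, z', a', b'} \<in> NRT G H"
    if "z' \<in> carrier G" "a' \<in> carrier G" "b' \<in> carrier G" "rc z' = rc z" "rc a' = rc a" "rc b' = rc (a \<otimes> h)"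
    for z' a' b'
  proof -
    have "rc ` {\<one>, z', a', b'} = rcosets H"
    proof (rule equalityI)
      show "rc ` {\<one>, z', a', b'} \<subseteq> rcosets H" using that a by (auto simp: rcosets_eq)
      show "rcosets H \<subseteq> rc ` {\<one>, z', a', b'}" using that four by (auto simp: rcosets_eq)
    qed
    moreover have "inj_on rc {\<one>, z', a', b'}" using that za r1 h by (auto simp: inj_on_def)
    ultimately show ?thesis using that by (auto simp: NRT_iff)
  qed
  have fixes_iff: "involution_fixes {\<one>, z', a', b'} \<longleftrightarrow> rc (a \<otimes> z') = rc a"
    if z': "z' \<in> carrier G" "rc z' = rc z" "z' \<otimes> z' \<in> H"
      and a': "a' \<in> carrier G" "rc a' = rc a" and b': "b' \<in> carrier G" "rc b' = rc (a \<otimes> h)" for z' a' b'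
  proof
    have az: "rc (a' \<otimes> z') = rc (a \<otimes> z')" "rc (b' \<otimes> z') = rc (a \<otimes> h \<otimes> z')" using that a by simp_all
    have zz': "rc (z' \<otimes> z') = rc \<one>" using that by (simp add: mem_H_iff[symmetric])
    assume "rc (a \<otimes> z') = rc a"
    then have "rc (a' \<otimes> z') = rc a'" using az that by simp
    then show "involution_fixes {\<one>, z', a', b'}"
      using that za unfolding involution_fixes_def by (intro bexI[of _ a'] bexI[of _ z']) auto
  next
    have az: "rc (a' \<otimes> z') = rc (a \<otimes> z')" "rc (b' \<otimes> z') = rc (a \<otimes> h \<otimes> z')" using that a by simp_all
    have zz': "rc (z' \<otimes> z') = rc \<one>" using that by (simp add: mem_H_iff[symmetric])
    have nz: "normalizing z'" using normalizing_rc[OF z(1) z'(1,2)] .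
    assume "involution_fixes {\<one>, z', a', b'}"
    then obtain x y where x: "x \<in> {\<one>, z', a', b'}" and y: "y \<in> {\<one>, z', a', b'}" "y \<noteq> \<one>"
      and yy: "y \<otimes> y \<in> H" and xy: "rc (x \<otimes> y) = rc x" unfolding involution_fixes_def by blast
    have xc: "x \<in> carrier G" "y \<in> carrier G" using x y that by auto
    \<comment> \<open>Otherwise \<open>y\<close> represents one moved coset and \<open>x\<close> the
      other. Right multiplication by \<open>y\<close> permutes the four cosets and takes the values
      \<open>rc y\<close>, \<open>rc \<one>\<close>, \<open>rc x\<close> at \<open>\<one>\<close>,
      \<open>y\<close>, \<open>x\<close>. This leaves \<open>rc z\<close> for
      \<open>z' \<otimes> y\<close>, but cancelling the normalizing \<open>z'\<close> would put
      \<open>y\<close> into \<open>H\<close>.\<close>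
    have "y = z'"
    proof (rule ccontr)
      assume "y \<noteq> z'"
      then have yab: "y = a' \<or> y = b'" using y by auto
      then have ry: "rc y \<noteq> rc \<one>" "rc y \<noteq> rc z" using that r1 za by auto
      have yy': "rc (y \<otimes> y) = rc \<one>" using yy xc by (simp add: mem_H_iff[symmetric])
      have zy: "rc (z' \<otimes> y) \<noteq> rc z'"
      proof
        assume "rc (z' \<otimes> y) = rc z'"
        then have "rc (z' \<otimes> y) = rc (z' \<otimes> \<one>)" using z' by simp
        then show False using ry xc nz by (simp only: rc_cancel_left one_closed)
      qed
      have "rc x \<noteq> rc \<one>"
      proof
        assume "rc x = rc \<one>"
        then have "rc (x \<otimes> y) = rc (\<one> \<otimes> y)" using xc by (subst rc_cancel_right) auto
        then show False using xy \<open>rc x = rc \<one>\<close> ry xc by simp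
      qed
      moreover have "rc x \<noteq> rc y"
      proof
        assume "rc x = rc y"
        then have "rc (x \<otimes> y) = rc (y \<otimes> y)" using xc by (subst rc_cancel_right) auto
        then show False using xy \<open>rc x = rc y\<close> ry yy' by simp
      qed
      moreover have "rc x \<noteq> rc z'" using zy xy x that za z'(1) by (auto)
      ultimately have x4: "rc x \<noteq> rc \<one>" "rc x \<noteq> rc y" "rc x \<noteq> rc z" using that by auto
      have ne: "rc (z' \<otimes> y) \<noteq> rc (\<one> \<otimes> y)" "rc (z' \<otimes> y) \<noteq> rc (y \<otimes> y)" "rc (z' \<otimes> y) \<noteq> rc (x \<otimes> y)"
        using that x4 ry za xc by (subst rc_cancel_right; auto)+
      have "rc (z' \<otimes> y) \<noteq> rc y" "rc (z' \<otimes> y) \<noteq> rc \<one>" "rc (z' \<otimes> y) \<noteq> rc x" "rc (z' \<otimes> y) \<noteq> rc z"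
        using ne zy z'(2) yy' xy xc by (simp_all del: rc_cancel_right)
      then show False
        using four[of "z' \<otimes> y"] four[OF xc(1)] four[OF xc(2)] x4 ry z' xc by auto
    qed
    then have xz: "rc (x \<otimes> z') = rc x" using xy by simp
    have "rc x \<noteq> rc \<one>"
    proof
      assume "rc x = rc \<one>"
      then have "rc (x \<otimes> z') = rc (\<one> \<otimes> z')" using xc z' by (subst rc_cancel_right) auto
      then show False using xz \<open>rc x = rc \<one>\<close> za z' by simp
    qed
    moreover have "rc x \<noteq> rc z"
    proof
      assume e: "rc x = rc z"
      then have "rc (x \<otimes> z') = rc (z' \<otimes> z')" using xc z' by (subst rc_cancel_right) auto
      then show False using xz e za zz' by simp
    qed
    ultimately consider "rc x = rc a" | "rc x = rc (a \<otimes> h)" using four[OF xc(1)] by auto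
    then show "rc (a \<otimes> z') = rc a"
    proof cases
      case 1
      then have "rc (x \<otimes> z') = rc (a \<otimes> z')" using xc z' a by (subst rc_cancel_right) auto
      then show ?thesis using xz 1 by simp
    next
      case 2
      then have "rc (x \<otimes> z') = rc (a \<otimes> h \<otimes> z')" using xc z' a by (subst rc_cancel_right) auto
      then have ah: "rc (a \<otimes> h \<otimes> z') = rc (a \<otimes> h)" using xz 2 by simp
      \<comment> \<open>Right multiplication by \<open>z'\<close> exchanges \<open>rc \<one>\<close>
        and \<open>rc z\<close>, so if it fixes one moved coset it fixes the other.\<close>
      have ne: "rc (a \<otimes> z') \<noteq> rc (\<one> \<otimes> z')" "rc (a \<otimes> z') \<noteq> rc (z' \<otimes> z')" "rc (a \<otimes> z') \<noteq> rc (a \<otimes> h \<otimes> z')"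
        using a z' za r1 h by (subst rc_cancel_right; auto)+
      have "rc (a \<otimes> z') \<noteq> rc z" "rc (a \<otimes> z') \<noteq> rc \<one>" "rc (a \<otimes> z') \<noteq> rc (a \<otimes> h)"
        using ne z' zz' ah by (simp_all del: rc_cancel_right)
      then show ?thesis using four[of "a \<otimes> z'"] a z' by auto
    qed
  qed
  have index: "index = 4"
  proof -
    have "{\<one>, z, a, a \<otimes> h} \<in> NRT G H" using a by (intro NRT4) auto
    moreover have "card {\<one>, z, a, a \<otimes> h} = 4"
    proof -
      have "distinct [\<one>, z, a, a \<otimes> h]" using za r1 h(2) by auto
      from distinct_card[OF this] show ?thesis by simp
    qed
    ultimately show ?thesis using NRT_card by metis
  qed
  \<comment> \<open>In \<open>T1\<close> every element squares into \<open>H\<close>,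
    \<open>T2\<close> arises from it by \<open>swap_squares\<close>, and in \<open>T3\<close> the
    elements \<open>a\<close> and \<open>a \<otimes> h\<close> share a left inverse.\<close>
  have family: "\<exists>T1 T2 T3. T1 \<in> NRT G H \<and> T2 \<in> NRT G H \<and> T3 \<in> NRT G H \<and>
      rinv_card T1 = 4 \<and> square_card T1 = 4 \<and> rinv_card T2 = 4 \<and> square_card T2 < 4 \<and> rinv_card T3 < 4 \<and>
      (involution_fixes T2 \<longleftrightarrow> rc (a \<otimes> z') = rc a) \<and> (involution_fixes T3 \<longleftrightarrow> rc (a \<otimes> z') = rc a)"
    if z': "z' \<in> carrier G" "rc z' = rc z" for z'
  proof -
    let ?T1 = "{\<one>, z', a, ?b}" and ?T2 = "insert (inv h \<otimes> a) (insert (a \<otimes> h) ({\<one>, z', a, ?b} - {a, ?b}))"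
      and ?T3 = "{\<one>, z', a, a \<otimes> h}"
    have nz: "normalizing z'" using normalizing_rc[OF z(1) z'] .
    obtain g where g: "g \<in> H" "z' = g \<otimes> z" by (rule rc_eqE[OF z'(2,1)]) auto
    have "rc (z' \<otimes> z') = rc (z \<otimes> g \<otimes> z)" using g by (simp add: m_assoc)
    also have "\<dots> = rc (z \<otimes> z)" using g z by (subst rc_cancel_right) (auto simp: normalizing_def)
    finally have zz': "rc (z' \<otimes> z') = rc \<one>" using zz by simp
    then have zzH: "z' \<otimes> z' \<in> H" using z' by (simp add: mem_H_iff)
    have rb: "rc ?b = rc (a \<otimes> h)" using a h by simp
    have T1: "?T1 \<in> NRT G H" using a h z' by (intro NRT4) auto
    have bb: "?b \<otimes> ?b \<in> H"
    proof -
      have "?b \<otimes> ?b = inv h \<otimes> (a \<otimes> a) \<otimes> h" using a h by (simp add: m_assoc)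
      then show ?thesis using a h by simp
    qed
    have c1: "card ?T1 = 4" using NRT_card[OF T1] index by simp
    have "{x \<in> ?T1. x \<otimes> x \<in> H} = ?T1" using zzH a bb by (intro equalityI) auto
    then have s1: "square_card ?T1 = 4" using c1 by (simp only: square_card_def)
    have inv_self: "rc (inv x) = rc x" if "x \<in> carrier G" "x \<otimes> x \<in> H" for x
      using that by (simp add: mult_mem_H_iff)
    have "?l ` ?T1 = rc ` ?T1" using inv_self z' zzH a bb h by (intro image_cong) auto
    then have "rinv_card ?T1 = card (rc ` ?T1)" using rinv_card_eq[OF T1] by simp
    moreover have "inj_on rc ?T1" using T1 by (simp only: NRT_iff)
    ultimately have i1: "rinv_card ?T1 = 4" using card_image c1 by metis
    have T2: "?T2 \<in> NRT G H" "rinv_card ?T2 = 4" "square_card ?T2 < 4"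
      using swap_squares[OF a h T1] s1 i1 by auto
    have "?T2 = {\<one>, z', inv h \<otimes> a, a \<otimes> h}"
    proof -
      have "\<one> \<noteq> a" "\<one> \<noteq> ?b" "z' \<noteq> a" "z' \<noteq> ?b" using r1 rb za z' by metis+
      then show ?thesis by (intro equalityI) auto
    qed
    then have f2: "involution_fixes ?T2 \<longleftrightarrow> rc (a \<otimes> z') = rc a"
      using fixes_iff[OF z' zzH, of "inv h \<otimes> a" "a \<otimes> h"] a h by simp
    have T3: "?T3 \<in> NRT G H" using a h z' by (intro NRT4) auto
    have f3: "involution_fixes ?T3 \<longleftrightarrow> rc (a \<otimes> z') = rc a"
      using fixes_iff[OF z' zzH, of a "a \<otimes> h"] a h by simp
    have "?l ` {a, a \<otimes> h} = {?l a}" using a h by (simp add: group_norm)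
    moreover have "a \<noteq> a \<otimes> h" using h(2) by auto
    ultimately have "rinv_card ?T3 < 4" using rinv_card_le[OF T3, of "{a, a \<otimes> h}"] index by simp
    then show ?thesis using T1 i1 s1 T2 f2 T3 f3 by blast
  qed
  \<comment> \<open>Right multiplication by \<open>z\<close> exchanges \<open>rc \<one>\<close> and
    \<open>rc z\<close>, so the preimage \<open>?w\<close> of \<open>rc a\<close> lies in one of the
    two moved cosets. Hence exactly one of the representatives \<open>z\<close> and
    \<open>h \<otimes> z\<close> fixes \<open>rc a\<close>.\<close>
  have "(rc (a \<otimes> z) = rc a) \<noteq> (rc (a \<otimes> (h \<otimes> z)) = rc a)"
  proof -
    have "rc (a \<otimes> h \<otimes> z) \<noteq> rc (a \<otimes> z)" using a h by (subst rc_cancel_right) auto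
    moreover have "rc (a \<otimes> z) = rc a \<or> rc (a \<otimes> h \<otimes> z) = rc a"
    proof -
      let ?w = "a \<otimes> inv z"
      have e: "rc (?w \<otimes> z) = rc a" using a by (simp add: m_assoc)
      consider "rc ?w = rc \<one>" | "rc ?w = rc z" | "rc ?w = rc a" | "rc ?w = rc (a \<otimes> h)"
        using four[of ?w] a by auto
      then show ?thesis
      proof cases
        case 1
        then have "rc (?w \<otimes> z) = rc (\<one> \<otimes> z)" using a by (subst rc_cancel_right) auto
        then show ?thesis using e za by simp
      next
        case 2
        then have "rc (?w \<otimes> z) = rc (z \<otimes> z)" using a by (subst rc_cancel_right) auto
        then show ?thesis using e zz r1 by simp
      next
        case 3
        then have "rc (?w \<otimes> z) = rc (a \<otimes> z)" using a by (subst rc_cancel_right) auto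
        then show ?thesis using e by simp
      next
        case 4
        then have "rc (?w \<otimes> z) = rc (a \<otimes> h \<otimes> z)" using a by (subst rc_cancel_right) auto
        then show ?thesis using e by simp
      qed
    qed
    ultimately show ?thesis using a by (auto simp: m_assoc)
  qed
  moreover obtain T1 T2 T3 where T: "T1 \<in> NRT G H" "T2 \<in> NRT G H" "T3 \<in> NRT G H"
      "rinv_card T1 = 4" "square_card T1 = 4" "rinv_card T2 = 4" "square_card T2 < 4" "rinv_card T3 < 4"
      "involution_fixes T2 \<longleftrightarrow> rc (a \<otimes> z) = rc a" "involution_fixes T3 \<longleftrightarrow> rc (a \<otimes> z) = rc a"
    using family[of z] by auto
  moreover obtain U2 U3 where U: "U2 \<in> NRT G H" "U3 \<in> NRT G H"
      "rinv_card U2 = 4" "square_card U2 < 4" "rinv_card U3 < 4"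
      "involution_fixes U2 \<longleftrightarrow> rc (a \<otimes> (h \<otimes> z)) = rc a" "involution_fixes U3 \<longleftrightarrow> rc (a \<otimes> (h \<otimes> z)) = rc a"
    using family[of "h \<otimes> z"] h by auto
  ultimately show ?thesis
    by (intro five_classes[of T1 T2 U2 T3 U3]) (auto simp: invariants_def)
qed

end

section \<open>A pair of distinct paired orbits\<close>

lemma image_swap:
  assumes "p \<in> S" "q \<in> S" "f c = f q" "f d = f p"
  shows "f ` insert c (insert d (S - {p, q})) = f ` S"
  using assms by (auto simp: image_iff)

text \<open>Exactly one of \<open>t\<close> and \<open>u\<close> is counted, and the rest of the set
  is unchanged.\<close>

lemma card_exchange_neq:
  assumes "finite S" "t \<in> S" "u \<notin> S - {t}" "q t \<noteq> q u"
  shows "card {z \<in> S. q z} \<noteq> card {z \<in> insert u (S - {t}). q z}"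
proof -
  let ?W = "{z \<in> S - {t}. q z}"
  have "{z \<in> S. q z} = (if q t then insert t ?W else ?W)"
    "{z \<in> insert u (S - {t}). q z} = (if q u then insert u ?W else ?W)"
    using assms(2) by auto
  then show ?thesis using assms by auto
qed

text \<open>The assumption \<open>square\<close> says that no nontrivial orbit is paired with
  itself; \<open>h\<close> and \<open>k\<close> witness that the orbits of \<open>rc a\<close> and
  \<open>rc (inv a)\<close> are nontrivial.\<close>

locale paired_orbits = finite_subgroup +
  fixes a h k
  assumes a: "a \<in> carrier G" and h: "h \<in> H" "rc (a \<otimes> h) \<noteq> rc a"
    and k: "k \<in> H" "rc (inv a \<otimes> k) \<noteq> rc (inv a)"
    and square: "\<And>x. x \<in> carrier G \<Longrightarrow> x \<otimes> x \<in> H \<Longrightarrow> normalizing x"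
begin

lemma hk_carrier [simp]: "h \<in> carrier G" "k \<in> carrier G" "a \<in> carrier G"
  using h k a by auto

lemma not_normalizing: "\<not> normalizing a" "\<not> normalizing (inv a)"
  using h k by (auto simp: normalizing_def)

text \<open>If the orbits of \<open>rc a\<close> and \<open>rc (inv a)\<close> met, then
  \<open>inv a\<close> would lie in the double coset of \<open>a\<close>, and some element of
  \<open>rc a\<close> would square into \<open>H\<close>.\<close>

lemma separated:
  assumes g: "g \<in> H" "g' \<in> H"
  shows "rc (a \<otimes> g) \<noteq> rc (inv a \<otimes> g')"
proof
  assume eq: "rc (a \<otimes> g) = rc (inv a \<otimes> g')"
  obtain m where m: "m \<in> H" "inv a \<otimes> g' = m \<otimes> (a \<otimes> g)"
    by (rule rc_eqE[OF eq[symmetric]]) (use g in auto)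
  let ?n = "g \<otimes> inv g'"
  have n: "?n \<in> H" using g by simp
  have "inv a = inv a \<otimes> g' \<otimes> inv g'" using g a by (simp add: m_assoc)
  also have "\<dots> = m \<otimes> (a \<otimes> ?n)" using g m by (simp add: m_assoc)
  finally have "m \<otimes> (a \<otimes> ?n) \<otimes> a = \<one>" using a by (metis l_inv)
  then have "inv m \<otimes> (m \<otimes> (a \<otimes> ?n) \<otimes> a) = inv m" using m by simp
  then have "a \<otimes> (?n \<otimes> a) = inv m" using m g by (simp add: m_assoc)
  then have "(?n \<otimes> a) \<otimes> (?n \<otimes> a) = ?n \<otimes> inv m" using m g by (simp add: m_assoc)
  then have "normalizing (?n \<otimes> a)" using n m a by (intro square) auto
  then have "normalizing a" by (rule normalizing_rc) (use n a in auto)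
  then show False using not_normalizing by simp
qed

lemma distinct_rc:
  "rc a \<noteq> rc \<one>" "rc (a \<otimes> h) \<noteq> rc \<one>" "rc (inv a) \<noteq> rc \<one>" "rc (inv a \<otimes> k) \<noteq> rc \<one>"
  "rc a \<noteq> rc (a \<otimes> h)" "rc a \<noteq> rc (inv a)" "rc a \<noteq> rc (inv a \<otimes> k)"
  "rc (a \<otimes> h) \<noteq> rc (inv a)" "rc (a \<otimes> h) \<noteq> rc (inv a \<otimes> k)" "rc (inv a) \<noteq> rc (inv a \<otimes> k)"
  using rc_one_moved[OF a h] rc_one_moved[OF inv_closed[OF a] k] h(2) k(2)
    separated[of \<one> \<one>] separated[of \<one> k] separated[of h \<one>] separated[of h k] h(1) k(1) by auto

lemma conj_notin:
  "a \<otimes> (h \<otimes> inv a) \<notin> H" "a \<otimes> (inv h \<otimes> inv a) \<notin> H"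
  "inv a \<otimes> (k \<otimes> a) \<notin> H" "inv a \<otimes> (inv k \<otimes> a) \<notin> H"
proof -
  show 1: "a \<otimes> (h \<otimes> inv a) \<notin> H" "inv a \<otimes> (k \<otimes> a) \<notin> H"
    using h k by (simp_all add: rc_eq_iff m_assoc)
  show "a \<otimes> (inv h \<otimes> inv a) \<notin> H"
    using 1(1) H_closed(2)[of "a \<otimes> (inv h \<otimes> inv a)"] by (auto simp: group_norm)
  show "inv a \<otimes> (inv k \<otimes> a) \<notin> H"
    using 1(2) H_closed(2)[of "inv a \<otimes> (inv k \<otimes> a)"] by (auto simp: group_norm)
qed

text \<open>With \<open>b = k\<^sup>-\<^sup>1 a h\<close>, the left inverse map consists of the two transpositions \<open>a \<leftrightarrow> a\<^sup>-\<^sup>1\<close> and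
  \<open>b \<leftrightarrow> b\<^sup>-\<^sup>1\<close> in the first transversal and has them merged into a 4-cycle in the second.\<close>

lemma inverse_card_pair:
  "\<exists>S\<in>NRT G H. \<exists>S'\<in>NRT G H. rinv_card S = index \<and> rinv_card S' = index \<and> inverse_card S' < inverse_card S"
proof -
  let ?l = "\<lambda>y. rc (inv y)"
  let ?b = "inv k \<otimes> (a \<otimes> h)" and ?d = "inv h \<otimes> (inv a \<otimes> k)"
  let ?K = "{\<one>, a, ?b, inv a, ?d}"
  note [simp] = h(1) k(1)
  have d: "inv ?b = ?d" "inv ?d = ?b" by (simp_all add: group_norm)
  have rb: "rc ?b = rc (a \<otimes> h)" and rd: "rc ?d = rc (inv a \<otimes> k)" by simp_all
  have injr: "inj_on rc ?K" using distinct_rc by (auto simp: inj_on_def)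
  \<comment> \<open>The element \<open>?d\<close> is the group inverse of \<open>?b\<close>, so left
    inversion permutes \<open>?K\<close>; this lets the image grow to full size with
    \<open>?K\<close> kept.\<close>
  have injl: "inj_on ?l ?K"
    unfolding inj_on_def using distinct_rc d rb rd by (auto simp del: inv_mult_group)
  obtain S0 where S0: "S0 \<in> NRT G H" "?K \<subseteq> S0"
    by (rule NRT_extend[of ?K]) (use injr in auto)
  have "rinv_card S0 \<le> index" using rinv_card_le[OF S0(1), of "{}"] by simp
  then obtain S where S: "S \<in> NRT G H" "?K \<subseteq> S" "rinv_card S = index"
    using rinv_card_levels[OF S0 _ injl, of index] by blast
  \<comment> \<open>After the exchange the left inverse map runs through \<open>a\<close>,
    \<open>?c'\<close>, \<open>?b\<close>, \<open>?d'\<close> and back to \<open>a\<close>.\<close>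
  let ?c' = "inv h \<otimes> inv a" and ?d' = "inv a \<otimes> k"
  let ?S = "insert ?c' (insert ?d' (S - {inv a, ?d}))"
  have rc': "rc ?c' = rc (inv a)" by simp
  have ne: "inv a \<noteq> \<one>" "?d \<noteq> \<one>" "?d' \<noteq> inv a" "inv a \<noteq> ?d" "?d' \<noteq> \<one>"
    using distinct_rc rd by metis+
  have "insert ?d' (S - {?d}) \<in> NRT G H" by (rule NRT_exchange[OF S(1)]) (use S(2) ne in auto)
  then have "insert ?c' (insert ?d' (S - {?d}) - {inv a}) \<in> NRT G H"
    by (rule NRT_exchange) (use S(2) ne in auto)
  moreover have "insert ?d' (S - {?d}) - {inv a} = insert ?d' (S - {inv a, ?d})"
    using ne by (intro equalityI) auto
  ultimately have S': "?S \<in> NRT G H" by simp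
  have "?l ?c' = ?l ?d" "?l ?d' = ?l (inv a)" by (simp_all add: group_norm)
  then have "?l ` ?S = ?l ` S" using S(2) by (intro image_swap) auto
  then have rinv: "rinv_card ?S = index" using rinv_card_eq[OF S(1)] rinv_card_eq[OF S'] S(3) by simp
  have partner: "y = w" if "w \<in> ?S" "rc w = rc (inv x)" "y \<in> ?S" "y \<otimes> x \<in> H" "x \<in> carrier G" for x y w
  proof -
    have "rc y = rc (inv x)" using that NRT_carrier[OF S' that(3)] by (simp add: mult_mem_H_iff)
    then have "rc y = rc w" using that by simp
    then show ?thesis using NRT_inj[OF S' that(3,1)] by simp
  qed
  have mem: "a \<in> ?S" "?b \<in> ?S" "?c' \<in> ?S" "?d' \<in> ?S"
  proof -
    have "a \<noteq> inv a" "a \<noteq> ?d" "?b \<noteq> inv a" "?b \<noteq> ?d" using distinct_rc rb rd by metis+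
    then show "a \<in> ?S" "?b \<in> ?S" "?c' \<in> ?S" "?d' \<in> ?S" using S(2) by auto
  qed
  have no: "x \<notin> {a, ?b, ?c', ?d'}" if y: "y \<in> ?S" "y \<otimes> x \<in> H" "x \<otimes> y \<in> H" for x y
  proof
    assume "x \<in> {a, ?b, ?c', ?d'}"
    then consider "x = a" | "x = ?b" | "x = ?c'" | "x = ?d'" by blast
    then show False
    proof cases
      case 1
      then have "y = ?c'" using partner[OF mem(3), of x y] y by simp
      then show False using y 1 conj_notin by (simp add: m_assoc)
    next
      case 2
      then have "y = ?d'" using partner[OF mem(4), of x y] y d rd by simp
      then have "inv k \<otimes> (a \<otimes> (h \<otimes> inv a)) \<otimes> k \<in> H" using y 2 by (simp add: m_assoc)
      from H_closed(1)[OF H_closed(1)[OF k(1) this] H_closed(2)[OF k(1)]]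
      show False using conj_notin by (simp add: m_assoc)
    next
      case 3
      then have "y = ?b" using partner[OF mem(2), of x y] y rb by (simp add: group_norm)
      then have "inv h \<otimes> (inv a \<otimes> (inv k \<otimes> a)) \<otimes> h \<in> H" using y 3 by (simp add: m_assoc)
      from H_closed(1)[OF H_closed(1)[OF h(1) this] H_closed(2)[OF h(1)]]
      show False using conj_notin by (simp add: m_assoc)
    next
      case 4
      then have "y = a" using partner[OF mem(1), of x y] y by (simp add: group_norm)
      then show False using y 4 conj_notin by (simp add: m_assoc)
    qed
  qed
  have inS: "x \<in> S" if "x \<in> ?S" "x \<notin> {a, ?b, ?c', ?d'}" for x using that by blast
  let ?P = "\<lambda>S. {x \<in> S. \<exists>y\<in>S. x \<otimes> y \<in> H \<and> y \<otimes> x \<in> H}"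
  \<comment> \<open>No member of the 4-cycle has a two-sided inverse, so the mutually inverse pairs
    of \<open>?S\<close> lie outside it and are already pairs in \<open>S\<close>.\<close>
  have "?P ?S \<subseteq> ?P S - {a}"
  proof
    fix x assume "x \<in> ?P ?S"
    then obtain y where xy: "x \<in> ?S" "y \<in> ?S" "x \<otimes> y \<in> H" "y \<otimes> x \<in> H" by blast
    note nx = no[OF xy(2,4,3)] and ny = no[OF xy(1,3,4)]
    have "x \<noteq> a" using nx by simp
    then show "x \<in> ?P S - {a}" using inS[OF xy(1) nx] inS[OF xy(2) ny] xy by blast
  qed
  moreover have "a \<in> ?P S" using S(2) by (auto intro!: bexI[of _ "inv a"])
  ultimately have "?P ?S \<subset> ?P S" by blast
  then have "inverse_card ?S < inverse_card S"
    unfolding inverse_card_def using NRT_finite[OF S(1)] by (intro psubset_card_mono) auto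
  then show ?thesis using S S' rinv by blast
qed

text \<open>The elements \<open>a\<close> and \<open>a \<otimes> h\<close> share a left inverse, and
  so do \<open>inv a\<close> and \<open>inv a \<otimes> k\<close>, which costs two values. The set
  \<open>X\<close> measures additional losses.\<close>

lemma four_le:
  assumes S: "S \<in> NRT G H" "{a, a \<otimes> h, inv a, inv a \<otimes> k} \<subseteq> S"
    and X: "X \<subseteq> S" "X \<inter> {a, a \<otimes> h, inv a, inv a \<otimes> k} = {}"
  shows "rinv_card S + 2 + card X \<le> index + card ((\<lambda>y. rc (inv y)) ` X - {rc a, rc (inv a)})"
proof -
  let ?l = "\<lambda>y. rc (inv y)" and ?K = "{a, a \<otimes> h, inv a, inv a \<otimes> k}"
  note [simp] = h(1) k(1)
  have "distinct [a, a \<otimes> h, inv a, inv a \<otimes> k]" using distinct_rc by auto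
  from distinct_card[OF this] have K4: "card ?K = 4" by simp
  have finX: "finite X" using X(1) NRT_finite[OF S(1)] by (rule finite_subset)
  have "?l ` ?K = {rc a, rc (inv a)}" by (simp add: group_norm insert_commute)
  then have "?l ` (?K \<union> X) = {rc a, rc (inv a)} \<union> (?l ` X - {rc a, rc (inv a)})"
    by (simp only: image_Un Un_Diff_cancel)
  then have "card (?l ` (?K \<union> X)) \<le> card {rc a, rc (inv a)} + card (?l ` X - {rc a, rc (inv a)})"
    using card_Un_le by metis
  moreover have "card {rc a, rc (inv a)} \<le> 2" by (simp add: card_insert_if)
  moreover have "card (?K \<union> X) = 4 + card X" using K4 finX X(2) by (subst card_Un_disjoint) auto
  ultimately show ?thesis using rinv_card_le[OF S(1), of "?K \<union> X"] S(2) X(1) by simp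
qed

lemma levels_from:
  assumes "S \<in> NRT G H" "rinv_card S \<le> j" "j \<le> index"
  shows "\<exists>T\<in>NRT G H. rinv_card T = j"
  using rinv_card_levels[OF assms(1), of "{\<one>}" j] NRT_one[OF assms(1)] assms(2,3) by auto

text \<open>A fifth moved coset lets the image size drop by 3. This gives four sizes, and the full
  size occurs twice by \<open>inverse_card_pair\<close>.\<close>

lemma five_classes_extra:
  assumes e: "e \<in> carrier G" "\<not> normalizing e"
    "rc e \<notin> {rc a, rc (a \<otimes> h), rc (inv a), rc (inv a \<otimes> k)}"
  shows "5 \<le> card (nrt_iso_classes G H)"
proof -
  let ?l = "\<lambda>y. rc (inv y)" and ?K = "{a, a \<otimes> h, inv a, inv a \<otimes> k}"
  note [simp] = h(1) k(1)
  have e1: "rc e \<noteq> rc \<one>" using e normalizing_rc[OF normalizing_H[OF H_closed(3)]] by auto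
  have "\<exists>S\<in>NRT G H. rinv_card S + 3 \<le> index"
  \<comment> \<open>If \<open>rc e\<close> lies in one of the two orbits, a representative of it
    repeats the left inverse of \<open>a\<close> or \<open>inv a\<close>; otherwise \<open>e\<close>
    and a translate \<open>e \<otimes> m\<close> share theirs.\<close>
  proof (cases "\<exists>y\<in>{a, inv a}. \<exists>g\<in>H. rc e = rc (y \<otimes> g)")
    case True
    then obtain y g where y: "y \<in> {a, inv a}" "g \<in> H" "rc e = rc (y \<otimes> g)" by blast
    have yc: "y \<in> carrier G" using y by auto
    have ne: "rc (y \<otimes> g) \<notin> {rc \<one>, rc a, rc (a \<otimes> h), rc (inv a), rc (inv a \<otimes> k)}" using e e1 y by simp
    obtain S where S: "S \<in> NRT G H" "{\<one>, a, a \<otimes> h, inv a, inv a \<otimes> k, y \<otimes> g} \<subseteq> S"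
      by (rule NRT_extend[of "{\<one>, a, a \<otimes> h, inv a, inv a \<otimes> k, y \<otimes> g}"])
        (use yc y(2) ne distinct_rc in \<open>auto simp: inj_on_def\<close>)
    have "?l (y \<otimes> g) \<in> {rc a, rc (inv a)}" using y by (auto simp: group_norm)
    then have "?l ` {y \<otimes> g} - {rc a, rc (inv a)} = {}" by (intro equalityI) blast+
    moreover have "{y \<otimes> g} \<inter> ?K = {}" using ne by auto
    moreover have "?K \<subseteq> S" "{y \<otimes> g} \<subseteq> S" using S(2) by simp_all
    ultimately have "rinv_card S + 2 + card {y \<otimes> g} \<le> index + card ({} :: 'a set set)"
      using four_le[OF S(1), of "{y \<otimes> g}"] by metis
    then show ?thesis using S(1) by (intro bexI[of _ S]) auto
  next
    case False
    obtain m where m: "m \<in> H" "rc (e \<otimes> m) \<noteq> rc e" using e by (auto simp: normalizing_def)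
    have em: "rc (e \<otimes> m) \<noteq> rc (y \<otimes> g)" if "y \<in> {a, inv a}" "g \<in> H" for y g
    proof
      assume "rc (e \<otimes> m) = rc (y \<otimes> g)"
      then have "rc (e \<otimes> m \<otimes> inv m) = rc (y \<otimes> g \<otimes> inv m)"
        using m e that by (subst rc_cancel_right) auto
      then have "rc e = rc (y \<otimes> (g \<otimes> inv m))" using m e that by (auto simp: m_assoc)
      moreover have "g \<otimes> inv m \<in> H" using that m by simp
      ultimately show False using False that(1) by blast
    qed
    have ne: "rc (e \<otimes> m) \<notin> {rc \<one>, rc a, rc (a \<otimes> h), rc (inv a), rc (inv a \<otimes> k)}"
      using em[of a \<one>] em[of a h] em[of "inv a" \<one>] em[of "inv a" k] rc_one_moved[OF e(1) m] by auto
    obtain S where S: "S \<in> NRT G H" "{\<one>, a, a \<otimes> h, inv a, inv a \<otimes> k, e, e \<otimes> m} \<subseteq> S"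
      by (rule NRT_extend[of "{\<one>, a, a \<otimes> h, inv a, inv a \<otimes> k, e, e \<otimes> m}"])
        (use e e1 m ne distinct_rc in \<open>auto simp: inj_on_def\<close>)
    have "?l (e \<otimes> m) = ?l e" using e m by (simp add: group_norm)
    then have "?l ` {e, e \<otimes> m} - {rc a, rc (inv a)} \<subseteq> {?l e}" by auto
    then have "card (?l ` {e, e \<otimes> m} - {rc a, rc (inv a)}) \<le> card {?l e}" by (intro card_mono) auto
    moreover have "e \<noteq> e \<otimes> m" using m(2) by metis
    then have "card {e, e \<otimes> m} = 2" by simp
    moreover have "{e, e \<otimes> m} \<inter> ?K = {}" using ne e by auto
    ultimately have "rinv_card S + 3 \<le> index" using four_le[OF S(1), of "{e, e \<otimes> m}"] S(2) by simp
    then show ?thesis using S(1) by blast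
  qed
  then obtain S where S: "S \<in> NRT G H" "rinv_card S + 3 \<le> index" by blast
  obtain T1 T1' where T1: "T1 \<in> NRT G H" "T1' \<in> NRT G H" "rinv_card T1 = index" "rinv_card T1' = index"
    "inverse_card T1' < inverse_card T1" using inverse_card_pair by blast
  have le: "rinv_card S \<le> index - 1" "rinv_card S \<le> index - 2" "rinv_card S \<le> index - 3" using S(2) by linarith+
  obtain T2 where T2: "T2 \<in> NRT G H" "rinv_card T2 = index - 1" using levels_from[OF S(1) le(1)] by auto
  obtain T3 where T3: "T3 \<in> NRT G H" "rinv_card T3 = index - 2" using levels_from[OF S(1) le(2)] by auto
  obtain T4 where T4: "T4 \<in> NRT G H" "rinv_card T4 = index - 3" using levels_from[OF S(1) le(3)] by auto
  show ?thesis
    by (rule five_classes[of T1 T1' T2 T3 T4]) (use T1 T2 T3 T4 S(2) in \<open>auto simp: invariants_def\<close>)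
qed

text \<open>With both orbits of size 2, full image size gives two classes by
  \<open>inverse_card_pair\<close>, size \<open>index - 1\<close> gives two by
  \<open>chain_card\<close>, and a smaller size gives the fifth.\<close>

lemma five_classes_chain:
  assumes all: "\<And>c. c \<in> carrier G \<Longrightarrow> \<not> normalizing c \<Longrightarrow>
    rc c \<in> {rc a, rc (a \<otimes> h), rc (inv a), rc (inv a \<otimes> k)}"
  shows "5 \<le> card (nrt_iso_classes G H)"
proof -
  let ?l = "\<lambda>y. rc (inv y)" and ?d = "inv h \<otimes> (inv a \<otimes> k)"
  let ?K = "{\<one>, a, a \<otimes> h, inv a, ?d}"
  note [simp] = h(1) k(1)
  have rd: "rc ?d = rc (inv a \<otimes> k)" by simp
  have nd: "\<not> normalizing ?d" 
    using not_normalizing(2) normalizing_rc[of ?d "inv a \<otimes> k"] rd normalizing_mult_right_iff[of "inv a" k] by auto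
  have nK: "\<not> normalizing x" if "x \<in> {a, a \<otimes> h, inv a, ?d}" for x
    using that nd not_normalizing normalizing_mult_right_iff[of a h] by auto
  have ld: "?l ?d = rc (a \<otimes> h)" by (simp add: group_norm)

  have out: "normalizing x" if S: "S \<in> NRT G H" "?K \<subseteq> S" and x: "x \<in> S" "x \<notin> ?K" for S x
  proof (rule ccontr)
    assume "\<not> normalizing x"
    then have "rc x \<in> rc ` {a, a \<otimes> h, inv a, ?d}" using all[of x] NRT_carrier[OF S(1) x(1)] by auto
    then obtain y where y: "y \<in> {a, a \<otimes> h, inv a, ?d}" "rc x = rc y" by (rule imageE)
    then have "y \<in> S" using S(2) by blast
    then have "x = y" using NRT_inj[OF S(1) x(1), of y] y(2) by simp
    then show False using y(1) x(2) by blast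
  qed

  \<comment> \<open>Only \<open>?d\<close> lacks a right inverse: the left inverses of elements of
    \<open>?K\<close> avoid its coset, and those of the other elements lie in fixed cosets.\<close>
  have hit: "(\<exists>y\<in>S. x \<otimes> y \<in> H) \<longleftrightarrow> x \<noteq> ?d" if S: "S \<in> NRT G H" "?K \<subseteq> S" and x: "x \<in> S" for S x
  proof
    assume "\<exists>y\<in>S. x \<otimes> y \<in> H"
    then obtain y where y: "y \<in> S" "x \<otimes> y \<in> H" by blast
    show "x \<noteq> ?d"
    proof
      assume "x = ?d"
      then have e: "rc (inv y) = rc (inv a \<otimes> k)"
        using y NRT_carrier[OF S(1) y(1)] rd by (simp add: mult_mem_H_iff)
      show False
      proof (cases "y \<in> ?K")
        case True
        then show False using e ld distinct_rc by (auto simp: group_norm)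
      next
        case False
        then have "normalizing (inv y)" using out[OF S y(1)] normalizing_inv by simp
        then show False using normalizing_rc[of "inv y" "inv a"] normalizing_rc[of "inv y" ?d] e rd nd by simp
      qed
    qed
  next
    assume xd: "x \<noteq> ?d"
    show "\<exists>y\<in>S. x \<otimes> y \<in> H"
    proof (cases "x \<in> ?K")
      case True
      then consider "x = \<one>" | "x = a" | "x = a \<otimes> h" | "x = inv a" using xd by blast
      then show ?thesis
      proof cases
        case 1
        then show ?thesis using S(2) by (intro bexI[of _ \<one>]) auto
      next
        case 2
        then show ?thesis using S(2) by (intro bexI[of _ "inv a"]) auto
      next
        case 3
        then have "x \<otimes> ?d = k" by (simp add: m_assoc)
        then show ?thesis using S(2) by (intro bexI[of _ ?d]) auto
      next
        case 4
        then show ?thesis using S(2) by (intro bexI[of _ a]) auto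
      qed
    next
      case False
      have n: "normalizing x" by (rule out[OF S x False])
      have xc: "x \<in> carrier G" by (rule NRT_carrier[OF S(1) x])
      obtain y where y: "y \<in> S" "rc y = rc (inv x)" by (rule NRT_rep[OF S(1) inv_closed[OF xc]])
      obtain g where g: "g \<in> H" "y = g \<otimes> inv x"
        by (rule rc_eqE[OF y(2)]) (use xc y NRT_carrier[OF S(1)] in auto)
      have "rc (x \<otimes> g) = rc x" using n g by (simp add: normalizing_def)
      then have "x \<otimes> y \<in> H" using g xc by (simp add: rc_eq_iff m_assoc)
      then show ?thesis using y by blast
    qed
  qed

  have rinv: "rinv_card S = index - 1" if S: "S \<in> NRT G H" "?K \<subseteq> S" for S
  proof -
    have "{x \<in> S. \<exists>y\<in>S. x \<otimes> y \<in> H} = S - {?d}"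
      using hit[OF S] by (intro equalityI) auto
    then show ?thesis using NRT_card[OF S(1)] NRT_finite[OF S(1)] S(2) by (simp add: rinv_card_def)
  qed

  let ?p = "\<lambda>z. rc (?d \<otimes> z) = rc ?d \<or> rc (?d \<otimes> z) = rc (a \<otimes> h)"
  \<comment> \<open>The element \<open>?d\<close> is the unique one outside the image, and left
    inverses are unique, so the chain in \<open>chain_card\<close> can only be \<open>?d\<close>,
    \<open>a \<otimes> h\<close>, \<open>inv a\<close>, \<open>a\<close>.\<close>
  have chain: "chain_card S = card {z \<in> S. z \<notin> ?K \<and> ?p z}" if S: "S \<in> NRT G H" "?K \<subseteq> S" for S
  proof -
    note uniq = NRT_inj[OF S(1)]
    have left: "x = w" if "x \<in> S" "w \<in> S" "x \<otimes> y \<in> H" "y \<in> carrier G" "rc (inv y) = rc w" for x y w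
      using that uniq[of x w] NRT_carrier[OF S(1)] by (simp add: mult_mem_H_iff)
    have K: "\<one> \<in> S" "a \<in> S" "a \<otimes> h \<in> S" "inv a \<in> S" "?d \<in> S" using S(2) by simp_all
    let ?c = "\<lambda>z d b c e. (\<forall>y\<in>S. d \<otimes> y \<notin> H) \<and> b \<otimes> d \<in> H \<and> c \<otimes> b \<in> H \<and> e \<otimes> c \<in> H \<and>
      z \<notin> {\<one>, e, b, c, d} \<and> (rc (d \<otimes> z) = rc d \<or> rc (d \<otimes> z) = rc b)"
    have eq: "(\<exists>d\<in>S. \<exists>b\<in>S. \<exists>c\<in>S. \<exists>e\<in>S. ?c z d b c e) \<longleftrightarrow> z \<notin> ?K \<and> ?p z" if z: "z \<in> S" for z
    proof
      assume "z \<notin> ?K \<and> ?p z"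
      moreover have "\<forall>y\<in>S. ?d \<otimes> y \<notin> H" using hit[OF S K(5)] by blast
      moreover have "a \<otimes> h \<otimes> ?d \<in> H" "inv a \<otimes> (a \<otimes> h) \<in> H" "a \<otimes> inv a \<in> H" by (simp_all add: m_assoc)
      ultimately have "?c z ?d (a \<otimes> h) (inv a) a" by blast
      then show "\<exists>d\<in>S. \<exists>b\<in>S. \<exists>c\<in>S. \<exists>e\<in>S. ?c z d b c e" using K by blast
    next
      assume "\<exists>d\<in>S. \<exists>b\<in>S. \<exists>c\<in>S. \<exists>e\<in>S. ?c z d b c e"
      then obtain d b c e where m: "d \<in> S" "b \<in> S" "c \<in> S" "e \<in> S" and q: "?c z d b c e" by blast
      have d: "d = ?d" using hit[OF S m(1)] q by blast
      have b: "b = a \<otimes> h" by (rule left[OF m(2) K(3), of d]) (use q d ld in auto)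
      have c: "c = inv a" by (rule left[OF m(3) K(4), of b]) (use q b in \<open>auto simp: inv_mult_group\<close>)
      have e: "e = a" by (rule left[OF m(4) K(2), of c]) (use q c in auto)
      show "z \<notin> ?K \<and> ?p z" using q unfolding d b c e by blast
    qed
    show ?thesis unfolding chain_card_def
      by (intro arg_cong[where f = card] Collect_cong conj_cong refl eq)
  qed

  \<comment> \<open>\<open>t\<close> moves the coset \<open>H\<close> although \<open>t\<^sup>2 \<in> H\<close>, because \<open>h\<^sup>2\<close> fixes \<open>H a\<close>; so it normalizes \<open>H\<close>.\<close>
  let ?t = "a \<otimes> (h \<otimes> inv a)"
  have tH: "?t \<notin> H" by (rule conj_notin)
  have t: "normalizing ?t"
  proof (rule square)
    have "\<not> normalizing (a \<otimes> (h \<otimes> h))" using not_normalizing by (simp add: normalizing_mult_right_iff)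
    then have "rc (a \<otimes> (h \<otimes> h)) \<in> {rc a, rc (a \<otimes> h), rc (inv a), rc (inv a \<otimes> k)}" by (intro all) auto
    moreover have "rc (a \<otimes> h \<otimes> h) \<noteq> rc (a \<otimes> h)" using h(2) by simp
    then have "rc (a \<otimes> (h \<otimes> h)) \<noteq> rc (a \<otimes> h)" by (simp add: m_assoc del: rc_cancel_right)
    ultimately have "rc (a \<otimes> (h \<otimes> h)) = rc a"
      using separated[of "h \<otimes> h" \<one>] separated[of "h \<otimes> h" k] by auto
    then show "?t \<otimes> ?t \<in> H" by (simp add: rc_eq_iff m_assoc)
  qed simp
  have tc: "?t \<in> carrier G" by simp
  have tK: "rc ?t \<notin> rc ` ?K"
  proof
    assume "rc ?t \<in> rc ` ?K"
    then obtain y where y: "y \<in> ?K" "rc ?t = rc y" by (rule imageE)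
    have "y \<in> carrier G" using y(1) by auto
    then have "normalizing y" using normalizing_rc[OF t] y(2) by simp
    then have "y = \<one>" using y(1) nK by blast
    then show False using y(2) tH tc by (simp only: mem_H_iff)
  qed
  obtain S where S: "S \<in> NRT G H" "insert ?t ?K \<subseteq> S"
  proof (rule NRT_extend[of "insert ?t ?K"])
    have "inj_on rc ?K" using distinct_rc rd by (auto simp: inj_on_def)
    then show "inj_on rc (insert ?t ?K)" using tK by (simp only: inj_on_insert Diff_subset_conv) blast
  qed auto
  then have SK: "?K \<subseteq> S" "?t \<in> S" by blast+
  \<comment> \<open>As \<open>g\<close> moves \<open>rc ?d\<close> to \<open>rc (inv a)\<close>,
    replacing \<open>?t\<close> by \<open>?u\<close> in its coset replaces the product coset
    \<open>rc (?d \<otimes> ?t)\<close> by \<open>rc (inv a \<otimes> ?t)\<close>.\<close>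
  obtain g where g: "g \<in> H" "rc (?d \<otimes> g) \<noteq> rc ?d" using nd by (auto simp: normalizing_def)
  let ?u = "g \<otimes> ?t"
  have uc: "?u \<in> carrier G" "rc ?u = rc ?t" using g by simp_all
  let ?S = "insert ?u (S - {?t})"
  have t1: "?t \<notin> ?K" using tK by blast
  have u1: "?u \<notin> ?K" using tK uc(2) by (metis imageI)
  have S': "?S \<in> NRT G H" by (rule NRT_exchange[OF S(1)]) (use SK t1 uc in auto)
  have SK': "?K \<subseteq> ?S" using SK t1 by blast

  \<comment> \<open>Both product cosets are moved, they differ, and they lie in a common orbit, so
    they exhaust that orbit. The two cosets tested by \<open>?p\<close> form one choice from each
    orbit, hence exactly one product satisfies it.\<close>
  have pt: "?p ?t \<noteq> ?p ?u"
  proof -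
    have "rc (?d \<otimes> g) = rc (inv a)"
    proof -
      have "rc (?d \<otimes> g) \<in> {rc a, rc (a \<otimes> h), rc (inv a), rc (inv a \<otimes> k)}"
        using nd g by (intro all) (simp_all add: normalizing_mult_right_iff)
      moreover have "rc (?d \<otimes> g) = rc (inv a \<otimes> (k \<otimes> g))" using g by (simp add: m_assoc)
      ultimately show ?thesis
        using separated[of \<one> "k \<otimes> g"] separated[of h "k \<otimes> g"] g rd by auto
    qed
    then have u: "rc (?d \<otimes> ?u) = rc (inv a \<otimes> ?t)"
      using g rc_mult_cong[of "?d \<otimes> g" "inv a" ?t] by (simp add: m_assoc)
    have move: "\<not> normalizing (x \<otimes> ?t)" if x: "x \<in> carrier G" "\<not> normalizing x" for x
    proof
      assume "normalizing (x \<otimes> ?t)"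
      then have "normalizing (x \<otimes> ?t \<otimes> inv ?t)" using normalizing_mult normalizing_inv[OF t] by blast
      then show False using x by (simp add: group_norm)
    qed
    have in4: "rc (?d \<otimes> ?t) \<in> {rc a, rc (a \<otimes> h), rc (inv a), rc (inv a \<otimes> k)}"
      "rc (inv a \<otimes> ?t) \<in> {rc a, rc (a \<otimes> h), rc (inv a), rc (inv a \<otimes> k)}"
      using move[OF _ nd] move[OF _ not_normalizing(2)] all[of "?d \<otimes> ?t"] all[of "inv a \<otimes> ?t"] by simp_all
    have ne: "rc (?d \<otimes> ?t) \<noteq> rc (inv a \<otimes> ?t)"
      using distinct_rc rd by (subst rc_cancel_right) auto
    have "rc (inv ?t \<otimes> k) = rc (inv ?t)" using normalizing_inv[OF t] by (simp add: normalizing_def)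
    \<comment> \<open>Carrying \<open>k\<close> past \<open>?t\<close> gives an element of
      \<open>H\<close>, which places both product cosets in the same orbit.\<close>
    then have m: "inv ?t \<otimes> k \<otimes> ?t \<in> H" (is "?m \<in> H") using tc by (simp only: rc_eq_iff inv_closed inv_inv m_closed hk_carrier)
    have "?d \<otimes> ?t = inv h \<otimes> (inv a \<otimes> ?t \<otimes> ?m)" by (simp add: group_norm)
    then have dm: "rc (?d \<otimes> ?t) = rc (inv a \<otimes> ?t \<otimes> ?m)" using m by (simp only: rc_mult_left h H_closed m_closed inv_closed hk_carrier tc H_carrier)
    have sep: "rc (?d \<otimes> ?t) \<in> {rc a, rc (a \<otimes> h)} \<longleftrightarrow> rc (inv a \<otimes> ?t) \<in> {rc a, rc (a \<otimes> h)}"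
    proof -
      have shift: "rc (?d \<otimes> ?t) = rc (y \<otimes> g \<otimes> ?m)"
        if "rc (inv a \<otimes> ?t) = rc (y \<otimes> g)" "y \<in> carrier G" "g \<in> H" for y g
        unfolding dm using that m by (intro rc_mult_cong) auto
      consider "rc (inv a \<otimes> ?t) = rc (a \<otimes> \<one>)" | "rc (inv a \<otimes> ?t) = rc (a \<otimes> h)"
        | "rc (inv a \<otimes> ?t) = rc (inv a \<otimes> \<one>)" | "rc (inv a \<otimes> ?t) = rc (inv a \<otimes> k)"
        using in4(2) by auto
      then show ?thesis
      proof cases
        case 1
        from shift[OF this] have "rc (?d \<otimes> ?t) = rc (a \<otimes> (\<one> \<otimes> ?m))" using m by (simp only: m_assoc one_closed H_closed(3) hk_carrier H_carrier)
        then show ?thesis using 1 in4(1) separated[of "\<one> \<otimes> ?m" \<one>] separated[of "\<one> \<otimes> ?m" k] m by auto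
      next
        case 2
        from shift[OF this] have "rc (?d \<otimes> ?t) = rc (a \<otimes> (h \<otimes> ?m))" using m by (simp only: m_assoc h hk_carrier H_carrier)
        then show ?thesis using 2 in4(1) separated[of "h \<otimes> ?m" \<one>] separated[of "h \<otimes> ?m" k] m by auto
      next
        case 3
        from shift[OF this] have "rc (?d \<otimes> ?t) = rc (inv a \<otimes> (\<one> \<otimes> ?m))" using m by (simp only: m_assoc one_closed H_closed(3) hk_carrier inv_closed H_carrier)
        then show ?thesis using 3 separated[of \<one> "\<one> \<otimes> ?m"] separated[of h "\<one> \<otimes> ?m"] m distinct_rc by auto
      next
        case 4
        from shift[OF this] have "rc (?d \<otimes> ?t) = rc (inv a \<otimes> (k \<otimes> ?m))" using m by (simp only: m_assoc k hk_carrier inv_closed H_carrier)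
        then show ?thesis using 4 separated[of \<one> "k \<otimes> ?m"] separated[of h "k \<otimes> ?m"] m distinct_rc by auto
      qed
    qed
    show ?thesis unfolding u rd using in4 ne sep distinct_rc by auto
  qed

  let ?q = "\<lambda>z. z \<notin> ?K \<and> ?p z"
  have "?u \<notin> S - {?t}" using NRT_inj[OF S(1) _ SK(2), of ?u] uc(2) by blast
  moreover have "?q ?t \<noteq> ?q ?u" using t1 u1 pt by blast
  ultimately have "card {z \<in> S. ?q z} \<noteq> card {z \<in> ?S. ?q z}"
    by (rule card_exchange_neq[OF NRT_finite[OF S(1)] SK(2), of ?u ?q])
  then have chain_ne: "chain_card S \<noteq> chain_card ?S"
    by (simp only: chain[OF S(1) SK(1)] chain[OF S' SK'] not_False_eq_True)
  have "\<exists>S'\<in>NRT G H. rinv_card S' = index - 1 \<and> chain_card S \<noteq> chain_card S'"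
    by (intro bexI[of _ ?S] conjI rinv[OF S' SK'] chain_ne S')
  then obtain S2 where S2: "S2 \<in> NRT G H" "rinv_card S2 = index - 1" "chain_card S \<noteq> chain_card S2" by blast
  have rS: "rinv_card S = index - 1" by (rule rinv[OF S(1) SK(1)])
  obtain T1 T1' where T1: "T1 \<in> NRT G H" "T1' \<in> NRT G H" "rinv_card T1 = index" "rinv_card T1' = index"
    "inverse_card T1' < inverse_card T1" using inverse_card_pair by blast
  obtain U where U: "U \<in> NRT G H" "{\<one>, a, a \<otimes> h, inv a, inv a \<otimes> k} \<subseteq> U"
    by (rule NRT_extend[of "{\<one>, a, a \<otimes> h, inv a, inv a \<otimes> k}"]) (use distinct_rc in \<open>auto simp: inj_on_def\<close>)
  have "rinv_card U + 2 \<le> index" using four_le[OF U(1), of "{}"] U(2) by simp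
  then have "distinct [invariants T1, invariants T1', invariants S, invariants S2, invariants U]"
    using T1 S2 rS by (auto simp: invariants_def)
  then show ?thesis by (intro five_classes) (use T1 S(1) S2 U(1) in simp_all)
qed

end

section \<open>Case distinction by self-paired nontrivial orbits and normality\<close>

theorem theorem1p1:
  fixes G :: "('a, 'm) monoid_scheme" and H :: "'a set"
  assumes "group G" and "finite (carrier G)" and "subgroup H G"
  shows "card (nrt_iso_classes G H) \<noteq> 4"
proof -
  interpret finite_subgroup G H using assms by (simp add: finite_subgroup_def finite_subgroup_axioms_def)
  have nh: "\<exists>h\<in>H. rc (x \<otimes>\<^bsub>G\<^esub> h) \<noteq> rc x" if "x \<in> carrier G" "\<not> normalizing x" for x
    using that by (auto simp: normalizing_def)
  have "card (nrt_iso_classes G H) \<le> 3 \<or> 5 \<le> card (nrt_iso_classes G H)"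
  \<comment> \<open>The first case is that of a nontrivial orbit paired with itself.\<close>
  proof (cases "\<exists>a\<in>carrier G. \<not> normalizing a \<and> a \<otimes>\<^bsub>G\<^esub> a \<in> H")
    case True
    then obtain a where a: "a \<in> carrier G" "a \<otimes>\<^bsub>G\<^esub> a \<in> H" and na: "\<not> normalizing a" by blast
    obtain h where h: "h \<in> H" "rc (a \<otimes>\<^bsub>G\<^esub> h) \<noteq> rc a" using nh[OF a(1) na] by blast
    show ?thesis
    proof (cases "\<exists>c\<in>carrier G. \<not> normalizing c \<and> rc c \<noteq> rc a \<and> rc c \<noteq> rc (a \<otimes>\<^bsub>G\<^esub> h)")
      case True
      then obtain c where c: "c \<in> carrier G" "\<not> normalizing c" "rc c \<noteq> rc a" "rc c \<noteq> rc (a \<otimes>\<^bsub>G\<^esub> h)"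
        by blast
      obtain k where "k \<in> H" "rc (c \<otimes>\<^bsub>G\<^esub> k) \<noteq> rc c" using nh[OF c(1,2)] by blast
      then show ?thesis using five_classes_involution[OF a h c(1) _ _ c(3,4)] by blast
    next
      case False
      then have all: "rc c = rc a \<or> rc c = rc (a \<otimes>\<^bsub>G\<^esub> h)" if "c \<in> carrier G" "\<not> normalizing c" for c
        using that by blast
      show ?thesis
      proof (cases "\<exists>z. normalizing z \<and> z \<notin> H")
        case True
        then obtain z where "normalizing z" "z \<notin> H" by blast
        then show ?thesis using five_classes_index_4[OF a h _ _ all] by blast
      next
        case False
        \<comment> \<open>Here \<open>H\<close> is the only fixed coset, and the two moved cosets
          complete the list.\<close>
        have "rcosets\<^bsub>G\<^esub> H = {rc \<one>\<^bsub>G\<^esub>, rc a, rc (a \<otimes>\<^bsub>G\<^esub> h)}"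
        proof (rule equalityI)
          show "rcosets\<^bsub>G\<^esub> H \<subseteq> {rc \<one>\<^bsub>G\<^esub>, rc a, rc (a \<otimes>\<^bsub>G\<^esub> h)}"
          proof
            fix C assume "C \<in> rcosets\<^bsub>G\<^esub> H"
            then obtain x where x: "x \<in> carrier G" "C = rc x" unfolding rcosets_eq by blast
            show "C \<in> {rc \<one>\<^bsub>G\<^esub>, rc a, rc (a \<otimes>\<^bsub>G\<^esub> h)}"
              using False all[OF x(1)] mem_H_iff[OF x(1)] x(2) by blast
          qed
          show "{rc \<one>\<^bsub>G\<^esub>, rc a, rc (a \<otimes>\<^bsub>G\<^esub> h)} \<subseteq> rcosets\<^bsub>G\<^esub> H"
            using a h by (simp add: rcosets_eq)
        qed
        moreover have "distinct [rc \<one>\<^bsub>G\<^esub>, rc a, rc (a \<otimes>\<^bsub>G\<^esub> h)]"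
          using rc_one_moved[OF a(1) h] h(2) by auto
        ultimately have "index = 3" using distinct_card unfolding index_def by fastforce
        then show ?thesis using card_classes_index_3 by blast
      qed
    qed
  next
    case False
    then have square: "normalizing x" if "x \<in> carrier G" "x \<otimes>\<^bsub>G\<^esub> x \<in> H" for x using that by blast
    show ?thesis
    proof (cases "\<forall>u\<in>carrier G. normalizing u")
      case True
      then have "card (nrt_iso_classes G H) \<le> 1" by (intro card_classes_normal) blast
      then show ?thesis by simp
    next
      case False
      then obtain a where a: "a \<in> carrier G" "\<not> normalizing a" by blast
      then have a': "\<not> normalizing (inv\<^bsub>G\<^esub> a)" using normalizing_inv[of "inv\<^bsub>G\<^esub> a"] by auto
      obtain h where h: "h \<in> H" "rc (a \<otimes>\<^bsub>G\<^esub> h) \<noteq> rc a" using nh[OF a] by blast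
      obtain k where k: "k \<in> H" "rc (inv\<^bsub>G\<^esub> a \<otimes>\<^bsub>G\<^esub> k) \<noteq> rc (inv\<^bsub>G\<^esub> a)"
        using nh[OF inv_closed[OF a(1)] a'] by blast
      interpret paired_orbits G H a h k by unfold_locales (use a h k square in auto)
      show ?thesis using five_classes_extra five_classes_chain by blast
    qed
  qed
  then show ?thesis by linarith
qed

end
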